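(* Let $\alpha_0,\alpha_1,\alpha_2>-1$ with $\alpha_1-\alpha_2\notin\mathbb Z$ and $|\alpha_1-\alpha_2|<1$, and let $\hat{\mathbf H}=(\hat{\mathbf H}_{n,m})_{n,m\ge 0}$ and $\check{\mathbf H}=(\check{\mathbf H}_{n,m})_{n,m\ge0}$ be the Jacobi--Piñeiro stochastic matrices of type II and type I, respectively, with parameters $\alpha_0,\alpha_1,\alpha_2$. Then their large $n$ limits are the same after transposition, that is, for every $k\in\{-2,-1,0,1,2\}$ both limits below exist and $$\lim_{n\to\infty}\check{\mathbf H}_{n,n+k}=\lim_{n\to\infty}\hat{\mathbf H}_{n+k,n}.$$
   Context: All matrices are semi-infinite with rows and columns indexed by $0,1,2,\dots$. Jacobi--Piñeiro system: on $\Delta=[0,1]$ take $w_1(x)=x^{\alpha_1}$, $w_2(x)=x^{\alpha_2}$ and $\mathrm d\mu(x)=(1-x)^{\alpha_0}\,\mathrm dx$, with $\alpha_0,\alpha_1,\alpha_2>-1$, $\alpha_1-\alpha_2\notin\mathbb Z$. Let $\xi_{2j}(x)=x^jw_1(x)$ and $\xi_{2j+1}(x)=x^jw_2(x)$ for $j\ge0$. Type II multiple orthogonal polynomials (on the stepline): $B_n$ is the monic polynomial of degree $n$ with $\int_\Delta B_n(x)\,\xi_j(x)\,\mathrm d\mu(x)=0$ for $0\le j\le n-1$. Type I linear forms: $Q_n$ is the linear combination of $\xi_0,\dots,\xi_n$ (so $Q_n=A^1_nw_1+A^2_nw_2$ with polynomials $A^1_n,A^2_n$) with $\int_\Delta x^jQ_n(x)\,\mathrm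 d\mu(x)=0$ for $0\le j\le n-1$ and normalized so that $\int_\Delta B_m(x)Q_k(x)\,\mathrm d\mu(x)=\delta_{m,k}$ for all $m,k\ge0$. Hessenberg matrix: $\mathbf H=(\mathbf H_{n,m})$ is the tetradiagonal matrix determined by $x\,B_n(x)=\sum_m\mathbf H_{n,m}B_m(x)$, i.e. $\mathbf H_{n,n+1}=1$, $\mathbf H_{n,n}=c_n$, $\mathbf H_{n,n-1}=b_n$, $\mathbf H_{n,n-2}=a_n$, all other entries zero. It also satisfies $x\,Q_m(x)=\sum_nQ_n(x)\mathbf H_{n,m}$. The entries $a_n,b_n,c_n$ are positive if and only if $|\alpha_1-\alpha_2|<1$. One has $B_n(1)>0$ and $Q_n(1)>0$ for all $n\ge 0$. Stochastic matrices: with $\sigma_{II}=\operatorname{diag}(B_0(1),B_1(1),B_2(1),\dots)$ (here $B_0(1)=1$) and $\sigma_I=\operatorname{diag}(Q_0(1),Q_1(1),Q_2(1),\dots)$, $$\hat{\mathbf H}=\sigma_{II}^{-1}\,\mathbf H\,\sigma_{II}\quad(\text{type II}),\qquad \check{\mathbf H}=\sigma_I^{-1}\,\mathbf H^{\top}\sigma_I\quad(\text{type I}).$$ *)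

theory Defs
  imports "HOL-Analysis.Analysis" "HOL-Computational_Algebra.Polynomial"
begin

text \<open>
  Jacobi--Pineiro multiple orthogonality on \<open>[0,1]\<close> with parameters \<open>\<alpha>0 \<alpha>1 \<alpha>2\<close>.
  Semi-infinite matrices are functions \<open>nat \<Rightarrow> nat \<Rightarrow> real\<close>, the row index coming first.

  For nonzero base, \<open>x powr \<alpha>\<close> is the real power; the convention \<open>0 powr \<alpha> = 0\<close> only affects
  the weights at \<open>x = 0\<close> and the density of the measure at \<open>x = 1\<close>, both of which are
  irrelevant for the integrals. The weights at \<open>x = 1\<close> are \<open>1 powr \<alpha> = 1\<close>.
\<close>

definition jp_measure :: "real \<Rightarrow> real measure" where
  "jp_measure \<alpha>0 = density (restrict_space lborel {0..1}) (\<lambda>x. ennreal ((1 - x) powr \<alpha>0))"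

definition jp_xi :: "real \<Rightarrow> real \<Rightarrow> nat \<Rightarrow> real \<Rightarrow> real" where
  "jp_xi \<alpha>1 \<alpha>2 i x = x ^ (i div 2) * x powr (if even i then \<alpha>1 else \<alpha>2)"

definition jp_B :: "real \<Rightarrow> real \<Rightarrow> real \<Rightarrow> nat \<Rightarrow> real poly" where
  "jp_B \<alpha>0 \<alpha>1 \<alpha>2 n = (THE p. degree p = n \<and> lead_coeff p = 1 \<and>
     (\<forall>j<n. (LINT x|jp_measure \<alpha>0. poly p x * jp_xi \<alpha>1 \<alpha>2 j x) = 0))"

definition jp_Q :: "real \<Rightarrow> real \<Rightarrow> real \<Rightarrow> nat \<Rightarrow> real \<Rightarrow> real" where
  "jp_Q \<alpha>0 \<alpha>1 \<alpha>2 n = (THE q. (\<exists>c. q = (\<lambda>x. \<Sum>i\<le>n. c i * jp_xi \<alpha>1 \<alpha>2 i x)) \<and>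
     (\<forall>j<n. (LINT x|jp_measure \<alpha>0. x ^ j * q x) = 0) \<and>
     (\<forall>m. (LINT x|jp_measure \<alpha>0. poly (jp_B \<alpha>0 \<alpha>1 \<alpha>2 m) x * q x) = (if m = n then 1 else 0)))"

text \<open>
  Row \<open>n\<close> consists of the coefficients of \<open>x B\<^sub>n(x)\<close> in the basis \<open>(B\<^sub>m)\<close> of the space of
  polynomials. That only the entries with \<open>n - 2 \<le> m \<le> n + 1\<close> can be nonzero is a
  consequence of this, not part of the definition.
\<close>

definition jp_H :: "real \<Rightarrow> real \<Rightarrow> real \<Rightarrow> nat \<Rightarrow> nat \<Rightarrow> real" where
  "jp_H \<alpha>0 \<alpha>1 \<alpha>2 n = (THE h. finite {m. h m \<noteq> 0} \<and>
     [:0, 1:] * jp_B \<alpha>0 \<alpha>1 \<alpha>2 n = (\<Sum>m | h m \<noteq> 0. smult (h m) (jp_B \<alpha>0 \<alpha>1 \<alpha>2 m)))"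

text \<open>Entries of \<open>diag(d)\<^sup>-\<^sup>1 M diag(d)\<close>.\<close>

definition diag_conj :: "(nat \<Rightarrow> real) \<Rightarrow> (nat \<Rightarrow> nat \<Rightarrow> real) \<Rightarrow> nat \<Rightarrow> nat \<Rightarrow> real" where
  "diag_conj d M n m = inverse (d n) * M n m * d m"

definition jp_H_typeII :: "real \<Rightarrow> real \<Rightarrow> real \<Rightarrow> nat \<Rightarrow> nat \<Rightarrow> real" where
  "jp_H_typeII \<alpha>0 \<alpha>1 \<alpha>2 =
     diag_conj (\<lambda>n. poly (jp_B \<alpha>0 \<alpha>1 \<alpha>2 n) 1) (jp_H \<alpha>0 \<alpha>1 \<alpha>2)"

definition jp_H_typeI :: "real \<Rightarrow> real \<Rightarrow> real \<Rightarrow> nat \<Rightarrow> nat \<Rightarrow> real" where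
  "jp_H_typeI \<alpha>0 \<alpha>1 \<alpha>2 =
     diag_conj (\<lambda>n. jp_Q \<alpha>0 \<alpha>1 \<alpha>2 n 1) (\<lambda>n m. jp_H \<alpha>0 \<alpha>1 \<alpha>2 m n)"

end

theory Submission
  imports Defs "HOL-Real_Asymp.Real_Asymp"
begin

text \<open>
  Let \<open>s 0, s 1, s 2, \<dots>\<close> be the exponents \<open>\<alpha>1, \<alpha>2, \<alpha>1 + 1, \<alpha>2 + 1, \<dots>\<close>, so that the weight
  functions are \<open>x powr s j\<close>. Pairing a polynomial with the \<open>j\<close>-th of them is evaluating its
  Mellin transform with respect to the measure at \<open>s j\<close>. For a polynomial \<open>p\<close> of degree at most
  \<open>n\<close> that transform is
  \<open>Gamma (\<sigma> + 1) * Gamma (\<alpha>0 + 1) / Gamma (\<sigma> + n + \<alpha>0 + 2)\<close> times a polynomial \<open>P\<close> in \<open>\<sigma>\<close> of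
  degree at most \<open>n\<close>; every such \<open>P\<close> occurs, the coefficient of \<open>x ^ n\<close> in \<open>p\<close> is a known multiple
  of \<open>P (- (n + \<alpha>0 + 1))\<close>, and \<open>p 1\<close> is the coefficient of \<open>\<sigma> ^ n\<close> in \<open>P\<close> (\<open>mellin_surj\<close>).
  Orthogonality makes \<open>P\<close> for \<open>B n\<close> a multiple of the product of the \<open>\<sigma> - s i\<close> with \<open>i < n\<close>, and
  monicity fixes the factor. So \<open>B n\<close> has an explicit transform, and the factor is \<open>B n 1\<close>.

  The coefficients of the type I form \<open>Q n\<close> are Lagrange weights on the nodes \<open>s 0, \<dots>, s n\<close>
  times a quotient of Gamma values: pairing \<open>Q n\<close> with a polynomial of degree \<open>m < n\<close> becomes a
  divided difference of order \<open>n\<close> of a polynomial of degree less than \<open>n\<close>, hence zero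
  (\<open>pairing_bpoly\<close>). Adding the coefficients expresses \<open>B n 1 * Q n 1\<close> as
  \<open>(n + \<alpha>0 + 1 + s n) / Gamma (\<alpha>0 + 1)\<close> times the divided difference on \<open>s 0, \<dots>, s n\<close> of
  \<open>\<sigma> \<mapsto> Gamma (\<sigma> + \<alpha>0 + n + 1) / Gamma (\<sigma> + 1)\<close> (\<open>sum_qcoef\<close>).

  Directly from the two conjugations, the type I entry at \<open>(n, m)\<close> is the type II entry at
  \<open>(m, n)\<close> times \<open>B m 1 * Q m 1 / (B n 1 * Q n 1)\<close> (\<open>jp_H_typeI_eq\<close>). Hence the theorem follows
  from two facts: the type II entries along each diagonal converge, and \<open>B n 1 * Q n 1\<close> has
  consecutive ratios tending to 1.

  For the first fact, the recurrence for \<open>x * B n\<close> is compared with the shift \<open>\<sigma> \<mapsto> \<sigma> + 1\<close> of the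
  Mellin transform. After cancellation it is an identity between cubic polynomials in \<open>\<sigma>\<close> whose
  coefficients are exactly the four type II entries of row \<open>n\<close> (\<open>hess_II_identity\<close>). Evaluation at
  two points where three of the cubics vanish, and comparison of the two highest coefficients,
  determine these entries; the limits are
  \<open>8/27\<close>, \<open>12/27\<close>, \<open>6/27\<close> and \<open>1/27\<close>.

  For the second fact, let \<open>D \<alpha> n\<close> be the above divided difference with \<open>\<alpha>\<close> in place of \<open>\<alpha>0\<close>. The
  Leibniz rule gives \<open>D \<alpha> (n + 1) - D \<alpha> n = (s (n + 1) + \<alpha> + n + 1) * D (\<alpha> - 1) (n + 1)\<close>, and
  partial sums of a positive sequence whose ratios tend to 1 have the same property, so the claim
  passes from \<open>\<alpha> - 1\<close> to \<open>\<alpha>\<close>. There remain \<open>\<alpha> = 0\<close>, where \<open>D\<close> is constantly 1, and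
  \<open>-1 < \<alpha> < 0\<close>. In the last range a partial fraction expansion of the Beta function turns \<open>D \<alpha> n\<close>
  into a series of positive terms \<open>t k\<close>, and \<open>D \<alpha> (n + 1)\<close> into the same series with weights
  \<open>k / (k + A)\<close>, where \<open>A\<close> is of order \<open>n\<close>. Telescoping \<open>k * t k\<close> shows that, in the mean
  with respect to \<open>t\<close>, \<open>1 / (k + A)\<close> is at most of order \<open>1 / n ^ 2\<close>; so the weights differ from 1 by
  \<open>A / (k + A)\<close>, which is at most of order \<open>1 / n\<close> in the mean (\<open>gamma_divdiff_ratio_bounds\<close>).
\<close>

section \<open>Divided differences\<close>

text \<open>
  The Lagrange form of the divided difference, with the nodes indexed by a set rather than by an
  initial segment: the inductions below remove arbitrary nodes.
\<close>

definition divdiff :: "(nat \<Rightarrow> real) \<Rightarrow> (real \<Rightarrow> real) \<Rightarrow> nat set \<Rightarrow> real" where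
  "divdiff s f I = (\<Sum>j\<in>I. f (s j) / (\<Prod>i\<in>I - {j}. s j - s i))"

lemma divdiff_cong:
  assumes "\<And>i. i \<in> I \<Longrightarrow> f (s i) = g (s i)"
  shows "divdiff s f I = divdiff s g I"
  using assms by (simp add: divdiff_def)

lemma divdiff_add: "divdiff s (\<lambda>x. f x + g x) I = divdiff s f I + divdiff s g I"
  by (simp add: divdiff_def add_divide_distrib sum.distrib)

lemma divdiff_cmult: "divdiff s (\<lambda>x. c * f x) I = c * divdiff s f I"
  by (simp add: divdiff_def sum_distrib_left)

text \<open>
  The factor \<open>x - s a\<close> vanishes at \<open>s a\<close> and cancels against the factor of that node in all other
  denominators. All further properties of divided differences are derived from this one.
\<close>

lemma divdiff_remove:
  assumes "finite I" "inj_on s I" "a \<in> I"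
  shows "divdiff s (\<lambda>x. (x - s a) * f x) I = divdiff s f (I - {a})"
proof -
  have "divdiff s (\<lambda>x. (x - s a) * f x) I =
      (\<Sum>j\<in>I - {a}. (s j - s a) * f (s j) / (\<Prod>i\<in>I - {j}. s j - s i))"
    unfolding divdiff_def using assms by (subst sum.remove[of I a]) auto
  also have "\<dots> = divdiff s f (I - {a})"
    unfolding divdiff_def
  proof (rule sum.cong[OF refl])
    fix j assume j: "j \<in> I - {a}"
    then have "s j - s a \<noteq> 0"
      using assms by (auto dest: inj_onD)
    moreover have "(\<Prod>i\<in>I - {j}. s j - s i) = (s j - s a) * (\<Prod>i\<in>I - {j} - {a}. s j - s i)"
      using assms j by (subst prod.remove[of _ a]) auto
    moreover have "I - {j} - {a} = I - {a} - {j}"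
      by auto
    ultimately show "(s j - s a) * f (s j) / (\<Prod>i\<in>I - {j}. s j - s i) =
        f (s j) / (\<Prod>i\<in>I - {a} - {j}. s j - s i)"
      by simp
  qed
  finally show ?thesis .
qed

text \<open>
  Multiplying by \<open>x - s a\<close> and by \<open>x - s b\<close> and subtracting expresses the divided difference through
  those on two smaller sets of nodes; with two nodes the two values are both equal to the constant.
\<close>

lemma divdiff_const:
  assumes "finite I" "inj_on s I" "card I \<ge> 2"
  shows "divdiff s (\<lambda>x. c) I = 0"
  using assms
proof (induction "card I" arbitrary: I rule: less_induct)
  case (less I)
  from \<open>card I \<ge> 2\<close> obtain a b where ab: "a \<in> I" "b \<in> I" "a \<noteq> b"
    by (metis card_2_iff' ex_card subset_iff)
  have "divdiff s (\<lambda>x. (x - s a) * c) I - divdiff s (\<lambda>x. (x - s b) * c) I =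
      (s b - s a) * divdiff s (\<lambda>x. c) I"
    by (simp add: divdiff_def sum_distrib_left flip: sum_subtractf diff_divide_distrib)
       (simp add: algebra_simps)
  then have eq: "(s b - s a) * divdiff s (\<lambda>x. c) I =
      divdiff s (\<lambda>x. c) (I - {a}) - divdiff s (\<lambda>x. c) (I - {b})"
    using divdiff_remove[of I s a "\<lambda>_. c"] divdiff_remove[of I s b "\<lambda>_. c"] less.prems ab by simp
  have ne: "s b - s a \<noteq> 0"
    using less.prems ab by (auto dest: inj_onD)
  have sub: "inj_on s (I - {x})" for x
    using less.prems(2) by (rule inj_on_diff)
  show ?case
  proof (cases "card I = 2")
    case True
    then have "I = {a, b}"
      using ab less.prems(1) by (metis card_2_iff doubleton_eq_iff insert_iff singletonD)
    then have "I - {a} = {b}" "I - {b} = {a}"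
      using ab by auto
    then show ?thesis
      using eq ne by (simp add: divdiff_def)
  next
    case False
    then have "divdiff s (\<lambda>x. c) (I - {x}) = 0" if "x \<in> I" for x
      using less.prems that sub by (intro less.hyps) auto
    then show ?thesis
      using eq ne ab by simp
  qed
qed

text \<open>
  Dividing \<open>p\<close> by \<open>x - s a\<close> lowers the degree and the number of nodes together, and the remainder is
  a constant.
\<close>

lemma divdiff_poly:
  assumes "finite I" "inj_on s I" "Suc (degree p) < card I"
  shows "divdiff s (poly p) I = 0"
  using assms
proof (induction "degree p" arbitrary: p I)
  case 0
  then obtain c where "p = [:c:]"
    by (metis degree_eq_zeroE)
  then show ?case
    using 0 divdiff_const[of I s c] by (simp add: fun_eq_iff divdiff_def)
next
  case (Suc d)
  then obtain a where a: "a \<in> I"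
    by fastforce
  have p: "poly p x = (x - s a) * poly (synthetic_div p (s a)) x + poly p (s a)" for x
    by (subst synthetic_div_correct'[of "s a" p, symmetric]) (simp add: algebra_simps)
  have "divdiff s (poly p) I =
      divdiff s (\<lambda>x. (x - s a) * poly (synthetic_div p (s a)) x + poly p (s a)) I"
    by (subst p[abs_def]) simp
  also have "\<dots> = divdiff s (poly (synthetic_div p (s a))) (I - {a}) + divdiff s (\<lambda>x. poly p (s a)) I"
    using Suc.prems a by (simp add: divdiff_add divdiff_remove)
  also have "divdiff s (\<lambda>x. poly p (s a)) I = 0"
    using Suc.prems by (intro divdiff_const) auto
  also have "divdiff s (poly (synthetic_div p (s a))) (I - {a}) = 0"
    using Suc a by (intro Suc.hyps) (auto simp: degree_synthetic_div intro: inj_on_diff)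
  finally show ?case
    by simp
qed

lemma divdiff_inverse_linear:
  assumes "finite I" "inj_on s I" "I \<noteq> {}" "\<And>i. i \<in> I \<Longrightarrow> s i + c \<noteq> 0"
  shows "divdiff s (\<lambda>x. 1 / (x + c)) I = (-1) ^ (card I - 1) / (\<Prod>i\<in>I. s i + c)"
  using assms(1,3,2,4)
proof (induction I rule: finite_ne_induct)
  case (singleton a)
  then show ?case
    by (simp add: divdiff_def)
next
  case (insert a I)
  have card: "card (insert a I) = Suc (card I)" "card I > 0"
    using insert by (auto simp: card_gt_0_iff)
  have "0 = divdiff s (\<lambda>x. 1) (insert a I)"
    using insert card by (subst divdiff_const) auto
  also have "\<dots> = divdiff s (\<lambda>x. (x - s a) * (1 / (x + c)) + (s a + c) * (1 / (x + c))) (insert a I)"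
  proof (intro divdiff_cong)
    fix i assume "i \<in> insert a I"
    then have "s i + c \<noteq> 0"
      by (rule insert.prems)
    moreover have "(s i - s a) * (1 / (s i + c)) + (s a + c) * (1 / (s i + c)) = (s i + c) / (s i + c)"
      by (simp flip: add_divide_distrib)
    ultimately show "1 = (s i - s a) * (1 / (s i + c)) + (s a + c) * (1 / (s i + c))"
      by simp
  qed
  also have "\<dots> = divdiff s (\<lambda>x. 1 / (x + c)) I + (s a + c) * divdiff s (\<lambda>x. 1 / (x + c)) (insert a I)"
    using insert by (simp only: divdiff_add divdiff_cmult) (subst divdiff_remove, auto)
  finally have "(s a + c) * divdiff s (\<lambda>x. 1 / (x + c)) (insert a I) =
      - divdiff s (\<lambda>x. 1 / (x + c)) I"
    by simp
  also have "\<dots> = - ((-1) ^ (card I - 1) / (\<Prod>i\<in>I. s i + c))"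
    using insert by (subst insert.IH) auto
  also have "\<dots> = (-1) ^ card I / (\<Prod>i\<in>I. s i + c)"
    using card by (cases "card I") auto
  finally have eq: "(s a + c) * divdiff s (\<lambda>x. 1 / (x + c)) (insert a I) =
      (-1) ^ card I / (\<Prod>i\<in>I. s i + c)" .
  have "s a + c \<noteq> 0"
    by (rule insert.prems) simp
  then have "divdiff s (\<lambda>x. 1 / (x + c)) (insert a I) =
      (s a + c) * divdiff s (\<lambda>x. 1 / (x + c)) (insert a I) / (s a + c)"
    by simp
  then show ?case
    unfolding eq using insert.hyps card by (simp add: mult.commute)
qed

text \<open>
  Division of \<open>p\<close> by \<open>x + c\<close> with remainder: the quotient has too small a degree to contribute.
\<close>

lemma divdiff_poly_over_linear:
  assumes "finite I" "inj_on s I" "degree p < card I" "\<And>i. i \<in> I \<Longrightarrow> s i + c \<noteq> 0"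
  shows "divdiff s (\<lambda>x. poly p x / (x + c)) I =
    (-1) ^ (card I - 1) * poly p (- c) / (\<Prod>i\<in>I. s i + c)"
proof -
  define q where "q = synthetic_div p (- c)"
  have p: "poly p x = (x + c) * poly q x + poly p (- c)" for x
    unfolding q_def by (subst synthetic_div_correct'[of "- c" p, symmetric]) (simp add: algebra_simps)
  have "I \<noteq> {}"
    using assms by auto
  have "divdiff s (\<lambda>x. poly p x / (x + c)) I =
      divdiff s (\<lambda>x. poly q x + poly p (- c) * (1 / (x + c))) I"
    using assms(4) by (intro divdiff_cong, subst p) (auto simp: field_simps)
  also have "\<dots> = divdiff s (poly q) I + poly p (- c) * divdiff s (\<lambda>x. 1 / (x + c)) I"
    by (simp only: divdiff_add divdiff_cmult)
  also have "divdiff s (poly q) I = 0"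
  proof (cases "degree p = 0")
    case True
    then have "q = 0"
      unfolding q_def by (simp add: synthetic_div_eq_0_iff)
    then show ?thesis
      by (simp add: divdiff_def)
  next
    case False
    then show ?thesis
      using assms by (intro divdiff_poly) (auto simp: q_def degree_synthetic_div)
  qed
  finally show ?thesis
    using divdiff_inverse_linear[OF assms(1,2) \<open>I \<noteq> {}\<close> assms(4)] by simp
qed

text \<open>
  Expand \<open>(1 - x) powr (b - 1)\<close> by the binomial series and integrate term by term against
  \<open>x powr (a - 1)\<close>. Because \<open>b < 1\<close> all terms are nonnegative, so that monotone convergence applies.
  The result is the partial fraction expansion of \<open>Beta a b\<close> as a function of \<open>a\<close>.
\<close>

section \<open>Partial fractions of the Beta function, Pochhammer symbols and ratio limits\<close>

lemma Beta_series:
  fixes a b :: real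
  assumes a: "a > 0" and b: "0 < b" "b < 1"
  shows "(\<lambda>k. pochhammer (1 - b) k / (fact k * (a + real k))) sums Beta a b"
proof -
  define c :: "nat \<Rightarrow> real" where "c k = pochhammer (1 - b) k / fact k" for k
  have c_nonneg: "c k \<ge> 0" for k
    using b by (simp add: c_def pochhammer_nonneg)
  define f where "f n x = (\<Sum>k<n. c k * x powr (a - 1 + real k))" for n x
  define g where "g x = x powr (a - 1) * (1 - x) powr (b - 1)" for x
  have binom: "(\<lambda>k. c k * x ^ k) sums (1 - x) powr (b - 1)" if "0 < x" "x < 1" for x
  proof -
    have "(b - 1 gchoose k) * (- x) ^ k = c k * x ^ k" for k
      by (simp add: gbinomial_pochhammer c_def power_minus[of x])
    then show ?thesis
      using gen_binomial_real[of "- x" "b - 1"] that by simp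
  qed
  have int_f: "(f n has_integral (\<Sum>k<n. c k * (1 / (a + real k)))) {0<..<1}" for n
    unfolding f_def
  proof (intro has_integral_sum has_integral_mult_right)
    fix k
    show "((\<lambda>x. x powr (a - 1 + real k)) has_integral 1 / (a + real k)) {0<..<1}"
      using has_integral_powr_from_0[of "a - 1 + real k" 1] a
      by (simp add: has_integral_Icc_iff_Ioo)
  qed auto
  have int_g: "(g has_integral Beta a b) {0<..<1}"
    using has_integral_Beta_real[OF a b(1)] unfolding g_def by (simp add: has_integral_Icc_iff_Ioo)
  have lim: "(\<lambda>n. f n x) \<longlonglongrightarrow> g x" if "x \<in> {0<..<1}" for x
  proof -
    have "(\<lambda>k. x powr (a - 1) * (c k * x ^ k)) sums (x powr (a - 1) * (1 - x) powr (b - 1))"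
      using that by (intro sums_mult binom) auto
    moreover have "x powr (a - 1) * (c k * x ^ k) = c k * x powr (a - 1 + real k)" for k
      using that by (simp add: powr_add powr_realpow)
    ultimately show ?thesis
      by (simp add: sums_def f_def g_def)
  qed
  have mono: "f n x \<le> f (Suc n) x" for n x
    by (simp add: f_def c_nonneg)
  have le: "f n x \<le> g x" if "x \<in> {0<..<1}" for n x
    using incseq_le[OF incseq_SucI lim[OF that]] mono by blast
  have I: "integral {0<..<1} (f n) = (\<Sum>k<n. c k * (1 / (a + real k)))" for n
    using int_f by (rule integral_unique)
  have f_nonneg: "f n x \<ge> 0" for n x
    by (auto simp: f_def c_nonneg intro!: sum_nonneg)
  have "bounded (range (\<lambda>n. integral {0<..<1} (f n)))"
  proof (rule boundedI[of _ "Beta a b"])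
    fix y assume "y \<in> range (\<lambda>n. integral {0<..<1} (f n))"
    then obtain n where y: "y = integral {0<..<1} (f n)"
      by auto
    have "integral {0<..<1} (f n) \<ge> 0"
      using int_f f_nonneg by (intro integral_nonneg) (auto simp: integrable_on_def)
    moreover have "integral {0<..<1} (f n) \<le> Beta a b"
      using int_f int_g le by (intro has_integral_le[OF _ int_g]) (auto simp: integrable_on_def I)
    ultimately show "norm y \<le> Beta a b"
      by (simp add: y)
  qed
  then have "(\<lambda>n. integral {0<..<1} (f n)) \<longlonglongrightarrow> integral {0<..<1} g"
    using int_f mono lim
    by (intro conjunct2[OF monotone_convergence_increasing]) (auto simp: integrable_on_def)
  then have "(\<lambda>n. \<Sum>k<n. c k * (1 / (a + real k))) \<longlonglongrightarrow> Beta a b"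
    using int_g by (simp add: I integral_unique)
  then show ?thesis
    by (simp add: sums_def c_def)
qed

text \<open>
  The Pochhammer symbol \<open>pochhammer (x + c) n\<close> as a polynomial in \<open>x\<close>.
\<close>

definition poch_poly :: "real \<Rightarrow> nat \<Rightarrow> real poly" where
  "poch_poly c n = (\<Prod>i<n. [:c + real i, 1:])"

lemma poly_poch_poly: "poly (poch_poly c n) x = pochhammer (x + c) n"
  by (simp add: poch_poly_def poly_prod pochhammer_prod lessThan_atLeast0 add_ac)

lemma degree_prod_linear: "degree (\<Prod>i\<in>I. [:c i, 1:] :: real poly) = card I"
  by (subst degree_prod_sum_eq) auto

lemma monic_prod_linear: "lead_coeff (\<Prod>i\<in>I. [:c i, 1:] :: real poly) = 1"
  by (simp add: lead_coeff_prod)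

lemma degree_poch_poly: "degree (poch_poly c n) = n"
  by (simp add: poch_poly_def degree_prod_linear)

lemma Gamma_ratio_real:
  fixes x :: real
  assumes "x > 0"
  shows "Gamma (x + real n) / Gamma x = pochhammer x n"
  using assms by (subst pochhammer_Gamma) (auto elim!: nonpos_Ints_cases)

lemma pochhammer_over_fact_tendsto_0:
  assumes "\<alpha> < (0::real)"
  shows "(\<lambda>m. pochhammer (1 + \<alpha>) m / fact m) \<longlonglongrightarrow> 0"
proof -
  have "(\<lambda>n. ((-1 - \<alpha>) gchoose n) / ((-1) ^ n / exp ((-1 - \<alpha> + 1) * of_real (ln (real n)))) * exp (\<alpha> * ln (real n)))
      \<longlonglongrightarrow> inverse (Gamma (- (-1 - \<alpha>))) * 0"
  proof (intro tendsto_mult gbinomial_asymptotic)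
    show "(\<lambda>n. exp (\<alpha> * ln (real n))) \<longlonglongrightarrow> 0"
      using assms by real_asymp
  qed
  moreover have "((-1 - \<alpha>) gchoose n) / ((-1) ^ n / exp ((-1 - \<alpha> + 1) * of_real (ln (real n)))) * exp (\<alpha> * ln (real n)) =
      pochhammer (1 + \<alpha>) n / fact n" for n
  proof -
    define E where "E = exp (\<alpha> * ln (real n))"
    have "exp ((-1 - \<alpha> + 1) * of_real (ln (real n))) = inverse E"
      by (simp add: E_def exp_minus)
    moreover have "E \<noteq> 0"
      by (simp add: E_def)
    moreover have "((-1 - \<alpha>) gchoose n) = (-1) ^ n * (pochhammer (1 + \<alpha>) n / fact n)"
      by (simp add: gbinomial_pochhammer add.commute)
    ultimately show ?thesis
      by (simp only: flip: E_def) (simp add: add.commute)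
  qed
  ultimately show ?thesis
    by simp
qed

lemma ratio_shift:
  fixes w :: "nat \<Rightarrow> real"
  assumes pos: "\<And>n. w n > 0" and lim: "(\<lambda>n. w (Suc n) / w n) \<longlonglongrightarrow> 1"
  shows "(\<lambda>n. w (n + m) / w n) \<longlonglongrightarrow> 1"
proof (induction m)
  case 0
  have "w n / w n = 1" for n
    using pos[of n] by simp
  then show ?case
    by simp
next
  case (Suc m)
  have "(\<lambda>n. w (Suc (n + m)) / w (n + m)) \<longlonglongrightarrow> 1"
    using LIMSEQ_ignore_initial_segment[OF lim, of m] by simp
  from tendsto_mult[OF this Suc.IH]
  have "(\<lambda>n. w (Suc (n + m)) / w (n + m) * (w (n + m) / w n)) \<longlonglongrightarrow> 1"
    by simp
  moreover have "w (Suc (n + m)) / w (n + m) * (w (n + m) / w n) = w (n + Suc m) / w n" for n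
    using pos[of "n + m"] by simp
  ultimately show ?case
    by (simp only:)
qed

text \<open>
  For each fixed \<open>J\<close> the last \<open>J\<close> summands of \<open>u n\<close> are asymptotically equal to \<open>w n\<close>, so \<open>u n / w n\<close>
  eventually exceeds any number below \<open>J\<close> and therefore tends to infinity.
\<close>

lemma partial_sums_ratio:
  fixes u w :: "nat \<Rightarrow> real"
  assumes pos: "\<And>n. w n > 0" and lim: "(\<lambda>n. w (Suc n) / w n) \<longlonglongrightarrow> 1"
    and u0: "u 0 > 0" and u_Suc: "\<And>n. u (Suc n) = u n + w n"
  shows "(\<lambda>n. u (Suc n) / u n) \<longlonglongrightarrow> 1"
proof -
  have u_pos: "u n > 0" for n
    by (induction n) (use u0 u_Suc pos in \<open>auto intro: add_pos_pos\<close>)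
  have u_ge: "u (n + J) \<ge> (\<Sum>j<J. w (n + j))" for n J
    by (induction J) (use u_pos[of n] u_Suc in auto)
  have "filterlim (\<lambda>n. u n / w n) at_top sequentially"
    unfolding filterlim_at_top
  proof
    fix Z :: real
    obtain J :: nat where J: "real J > Z"
      using reals_Archimedean2 by blast
    have "(\<lambda>n. \<Sum>j<J. w (n + j) / w (n + J)) \<longlonglongrightarrow> (\<Sum>j<J. 1 / 1)"
    proof (intro tendsto_sum)
      fix j
      have "(\<lambda>n. (w (n + j) / w n) / (w (n + J) / w n)) \<longlonglongrightarrow> 1 / 1"
        by (intro tendsto_divide ratio_shift pos lim) auto
      moreover have "(w (n + j) / w n) / (w (n + J) / w n) = w (n + j) / w (n + J)" for n
        using pos[of n] by simp
      ultimately show "(\<lambda>n. w (n + j) / w (n + J)) \<longlonglongrightarrow> 1 / 1"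
        by (simp only:)
    qed
    then have "(\<lambda>n. \<Sum>j<J. w (n + j) / w (n + J)) \<longlonglongrightarrow> real J"
      by simp
    from order_tendstoD(1)[OF this J]
    have "eventually (\<lambda>n. Z \<le> u (n + J) / w (n + J)) sequentially"
    proof eventually_elim
      case (elim n)
      have "(\<Sum>j<J. w (n + j) / w (n + J)) \<le> u (n + J) / w (n + J)"
        using u_ge[where n=n and J=J] pos[of "n + J"]
        by (simp flip: sum_divide_distrib add: divide_right_mono)
      with elim show ?case
        by simp
    qed
    then show "eventually (\<lambda>n. Z \<le> u n / w n) sequentially"
      by (simp add: eventually_sequentially_seg[of "\<lambda>n. Z \<le> u n / w n"])
  qed
  from tendsto_inverse_0_at_top[OF this]
  have "(\<lambda>n. 1 + inverse (u n / w n)) \<longlonglongrightarrow> 1 + 0"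
    by (intro tendsto_intros)
  moreover have "1 + inverse (u n / w n) = u (Suc n) / u n" for n
    using u_pos[of n] by (simp add: u_Suc field_simps)
  ultimately show ?thesis
    by simp
qed

text \<open>
  Every factor has a limit after division by \<open>N\<close>, and both sides of the equation have three factors.
\<close>

lemma product_quotient_limit:
  fixes h :: "nat \<Rightarrow> real"
  assumes eq: "\<And>N. h N * (x N * y N * z N) = x' N * y' N * z' N"
    and lim: "(\<lambda>N. x N / real N) \<longlonglongrightarrow> X" "(\<lambda>N. y N / real N) \<longlonglongrightarrow> Y" "(\<lambda>N. z N / real N) \<longlonglongrightarrow> Z"
      "(\<lambda>N. x' N / real N) \<longlonglongrightarrow> X'" "(\<lambda>N. y' N / real N) \<longlonglongrightarrow> Y'" "(\<lambda>N. z' N / real N) \<longlonglongrightarrow> Z'"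
    and nz: "X * Y * Z \<noteq> 0" and pos: "\<And>N. x N * y N * z N \<noteq> 0"
  shows "h \<longlonglongrightarrow> (X' * Y' * Z') / (X * Y * Z)"
proof -
  have "(\<lambda>N. (x' N / real N * (y' N / real N) * (z' N / real N)) / (x N / real N * (y N / real N) * (z N / real N)))
      \<longlonglongrightarrow> (X' * Y' * Z') / (X * Y * Z)"
    by (rule tendsto_divide[OF tendsto_mult[OF tendsto_mult[OF lim(4,5)] lim(6)] tendsto_mult[OF tendsto_mult[OF lim(1,2)] lim(3)] nz])
  moreover have "\<forall>\<^sub>F N in sequentially. (x' N / real N * (y' N / real N) * (z' N / real N)) / (x N / real N * (y N / real N) * (z N / real N)) = h N"
    using eventually_gt_at_top[of 0]
  proof eventually_elim
    case (elim N)
    have "h N = x' N * y' N * z' N / (x N * y N * z N)"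
      using eq[of N] pos[of N] by (metis nonzero_eq_divide_eq)
    then show ?case
      using elim by simp
  qed
  ultimately show ?thesis
    by (rule Lim_transform_eventually)
qed

lemma poly_eq_if_eventually_eq:
  fixes p q :: "real poly"
  assumes "\<And>t. t > T \<Longrightarrow> poly p t = poly q t"
  shows "p = q"
proof -
  have "{T<..} \<subseteq> {t. poly (p - q) t = 0}"
    using assms by auto
  moreover have "infinite {T<..}"
    by (rule infinite_Ioi)
  ultimately have "infinite {t. poly (p - q) t = 0}"
    using finite_subset by blast
  then have "p - q = 0"
    using poly_roots_finite by blast
  then show ?thesis
    by simp
qed

definition cubic :: "real \<Rightarrow> real \<Rightarrow> real \<Rightarrow> real poly" where
  "cubic a b c = [:a, 1:] * [:b, 1:] * [:c, 1:]"

lemma poly_cubic: "poly (cubic a b c) x = (x + a) * (x + b) * (x + c)"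
  by (simp add: cubic_def algebra_simps)

lemma coeff_cubic: "coeff (cubic a b c) 3 = 1" "coeff (cubic a b c) 2 = a + b + c"
  by (simp_all add: cubic_def numeral_eq_Suc)

lemma half_div2: "real j / 2 - 1 / 2 \<le> real (j div 2)" "real (j div 2) \<le> real j / 2"
  by (cases "even j"; auto elim!: evenE oddE)+

text \<open>
  The exponents of the weight functions in stepline order. The parameters \<open>a\<close> and \<open>b\<close> stand for
  \<open>\<alpha>1\<close> and \<open>\<alpha>2\<close>.
\<close>

section \<open>The exponents\<close>

definition node :: "real \<Rightarrow> real \<Rightarrow> nat \<Rightarrow> real" where
  "node a b j = real (j div 2) + (if even j then a else b)"

locale jp_nodes =
  fixes a b :: real
  assumes a: "a > -1" and b: "b > -1" and diff_nonint: "a - b \<notin> \<int>" and diff_less: "\<bar>a - b\<bar> < 1"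
begin

abbreviation s :: "nat \<Rightarrow> real" where "s \<equiv> node a b"

lemma node_gt: "s j > -1"
  using a b unfolding node_def by (smt (verit) of_nat_0_le_iff)

lemma node_add2: "s (Suc (Suc j)) = s j + 1"
  by (simp add: node_def)

lemma node_pos: "2 \<le> j \<Longrightarrow> s j > 0"
  using node_add2[of "j - 2"] node_gt[of "j - 2"] by (simp add: numeral_2_eq_2 Suc_diff_Suc)

lemma inj_node: "inj s"
proof (rule injI)
  fix i j assume eq: "s i = s j"
  have "even i \<longleftrightarrow> even j"
  proof (rule ccontr)
    assume "\<not> ?thesis"
    then have "a - b = real (j div 2) - real (i div 2) \<or> a - b = real (i div 2) - real (j div 2)"
      using eq by (auto simp: node_def split: if_splits)
    then show False
      using diff_nonint by (metis Ints_diff Ints_of_nat)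
  qed
  moreover from this have "i div 2 = j div 2"
    using eq by (auto simp: node_def split: if_splits)
  ultimately show "i = j"
    by (metis even_two_times_div_two odd_two_times_div_two_succ)
qed

lemma inj_on_node: "inj_on s I"
  using inj_node by (rule inj_on_subset) simp

lemma node_lower: "real j / 2 - 3 / 2 \<le> s j"
  using half_div2(1)[of j] a b by (simp add: node_def)

lemma node_upper: "s j \<le> real j / 2 + (\<bar>a\<bar> + \<bar>b\<bar>)"
proof -
  have "a \<le> \<bar>a\<bar> + \<bar>b\<bar>" "b \<le> \<bar>a\<bar> + \<bar>b\<bar>"
    by linarith+
  then show ?thesis
    using half_div2(2)[of j] by (auto simp: node_def)
qed

text \<open>
  The exponents increase up to an error of 1; this is where the bound on the difference of the two
  parameters enters.
\<close>

lemma node_mono: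
  assumes "i \<le> j"
  shows "s i \<le> s j + 1"
proof -
  have "real (i div 2) \<le> real (j div 2)"
    using assms by (simp add: div_le_mono)
  moreover have "a \<le> b + 1" "b \<le> a + 1"
    using diff_less by linarith+
  ultimately show ?thesis
    by (auto simp: node_def)
qed

lemma node_over_n: "(\<lambda>n. s n / real n) \<longlonglongrightarrow> 1 / 2"
proof (rule tendsto_sandwich)
  show "\<forall>\<^sub>F n in sequentially. (real n / 2 - 3 / 2) / real n \<le> s n / real n"
    using node_lower by (intro always_eventually allI divide_right_mono) auto
  show "\<forall>\<^sub>F n in sequentially. s n / real n \<le> (real n / 2 + (\<bar>a\<bar> + \<bar>b\<bar>)) / real n"
    using node_upper by (intro always_eventually allI divide_right_mono) auto
qed real_asymp+

text \<open>
  The numbers called \<open>D \<alpha> n\<close> in the introduction. For \<open>\<alpha> = \<alpha>0\<close> they govern the values of the type I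
  forms at 1, but the proof compares different \<open>\<alpha>\<close>.
\<close>

section \<open>Divided differences of quotients of Gamma functions\<close>

definition gamma_divdiff :: "real \<Rightarrow> nat \<Rightarrow> real" where
  "gamma_divdiff \<alpha> n = divdiff s (\<lambda>x. Gamma (x + \<alpha> + real n + 1) / Gamma (x + 1)) {..n}"

lemma gamma_divdiff_0: "gamma_divdiff \<alpha> 0 = Gamma (s 0 + \<alpha> + 1) / Gamma (s 0 + 1)"
  by (simp add: gamma_divdiff_def divdiff_def)

text \<open>
  Write the function for \<open>n + 1\<close> as the one for \<open>n\<close> times \<open>x + \<alpha> + n + 1\<close>, and split this factor into
  \<open>x - s (n + 1)\<close>, which removes the last node, and a constant. The function for \<open>(\<alpha>, n)\<close> is also the
  one for \<open>(\<alpha> - 1, n + 1)\<close>.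
\<close>

lemma gamma_divdiff_rec:
  assumes "\<alpha> \<ge> 0"
  shows "gamma_divdiff \<alpha> (Suc n) = gamma_divdiff \<alpha> n + (s (Suc n) + \<alpha> + real n + 1) * gamma_divdiff (\<alpha> - 1) (Suc n)"
proof -
  define h where "h x = Gamma (x + \<alpha> + real n + 1) / Gamma (x + 1)" for x
  have "gamma_divdiff \<alpha> (Suc n) =
      divdiff s (\<lambda>x. (x - s (Suc n)) * h x + (s (Suc n) + \<alpha> + real n + 1) * h x) {..Suc n}"
    unfolding gamma_divdiff_def
  proof (rule divdiff_cong)
    fix i
    have "s i + \<alpha> + real n + 1 > 0"
      using node_gt[of i] assms by linarith
    then have "Gamma (s i + \<alpha> + real n + 1 + 1) = (s i + \<alpha> + real n + 1) * Gamma (s i + \<alpha> + real n + 1)"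
      by (intro Gamma_plus1) (auto elim!: nonpos_Ints_cases)
    then have "Gamma (s i + \<alpha> + real (Suc n) + 1) = (s i + \<alpha> + real n + 1) * Gamma (s i + \<alpha> + real n + 1)"
      by (simp add: add_ac)
    then show "Gamma (s i + \<alpha> + real (Suc n) + 1) / Gamma (s i + 1) =
        (s i - s (Suc n)) * h (s i) + (s (Suc n) + \<alpha> + real n + 1) * h (s i)"
      by (simp add: h_def add_divide_distrib[symmetric] distrib_right[symmetric])
  qed
  also have "\<dots> = divdiff s h ({..Suc n} - {Suc n}) +
      (s (Suc n) + \<alpha> + real n + 1) * divdiff s h {..Suc n}"
    by (simp add: divdiff_add divdiff_cmult divdiff_remove inj_on_node)
  also have "{..Suc n} - {Suc n} = {..n}"
    by auto
  also have "divdiff s h {..n} = gamma_divdiff \<alpha> n"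
    by (simp add: gamma_divdiff_def h_def[abs_def])
  also have "divdiff s h {..Suc n} = gamma_divdiff (\<alpha> - 1) (Suc n)"
    by (simp add: gamma_divdiff_def h_def[abs_def] add_ac)
  finally show ?thesis .
qed

text \<open>
  For \<open>\<alpha> = 0\<close> the increment in the recursion is a divided difference of order \<open>n + 1\<close> of a polynomial
  of degree \<open>n\<close>.
\<close>

lemma gamma_divdiff_zero: "gamma_divdiff 0 n = 1"
proof (induction n)
  case 0
  have "Gamma (s 0 + 1) > 0"
    using node_gt[of 0] by (intro Gamma_real_pos) simp
  then show ?case
    by (simp add: gamma_divdiff_0)
next
  case (Suc n)
  have "gamma_divdiff (0 - 1) (Suc n) = divdiff s (poly (poch_poly 1 n)) {..Suc n}"
    unfolding gamma_divdiff_def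
  proof (rule divdiff_cong)
    fix i
    have "Gamma (s i + 1 + real n) / Gamma (s i + 1) = pochhammer (s i + 1) n"
      using node_gt[of i] by (intro Gamma_ratio_real) simp
    then show "Gamma (s i + (0 - 1) + real (Suc n) + 1) / Gamma (s i + 1) = poly (poch_poly 1 n) (s i)"
      by (simp add: poly_poch_poly add_ac)
  qed
  also have "\<dots> = 0"
    by (intro divdiff_poly) (auto simp: inj_on_node degree_poch_poly)
  finally show ?case
    using Suc by (subst gamma_divdiff_rec) auto
qed

text \<open>
  The terms, up to the factor \<open>Gamma (- \<alpha>)\<close>, of a positive series for the divided difference with
  \<open>-1 < \<alpha> < 0\<close>. They come from the poles of \<open>Gamma (\<sigma> + \<alpha> + n + 1)\<close>.
\<close>

definition gd_term :: "real \<Rightarrow> nat \<Rightarrow> nat \<Rightarrow> real" where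
  "gd_term \<alpha> n k = pochhammer (1 + \<alpha>) (k + n) / (fact k * (\<Prod>i\<le>n. s i + 1 + \<alpha> + real k + real n))"

text \<open>
  The quotient of Gamma values equals \<open>(x + 1) * pochhammer (x + \<alpha> + 2) m\<close> times
  \<open>Beta (x + \<alpha> + 2) (- \<alpha>) / Gamma (- \<alpha>)\<close>. Inserting the Beta series, each summand is a polynomial
  over a linear factor, so its divided difference is the value of the polynomial at the pole. Starting
  the Beta function at \<open>x + \<alpha> + 2\<close> rather than \<open>x + \<alpha> + 1\<close> keeps its argument positive for all nodes,
  which is why the index is a successor.
\<close>

lemma gd_term_sums:
  assumes \<alpha>: "-1 < \<alpha>" "\<alpha> < 0"
  shows "gd_term \<alpha> (Suc m) sums (Gamma (- \<alpha>) * gamma_divdiff \<alpha> (Suc m))"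
proof -
  \<comment> \<open>The factor \<open>x + 1\<close> turns \<open>Gamma (x + 2)\<close> in the Beta function into \<open>Gamma (x + 1)\<close>.\<close>
  define p where "p = [:1, 1:] * poch_poly (\<alpha> + 2) m"
  define c where "c k = pochhammer (1 + \<alpha>) k / fact k" for k
  have poly_p: "poly p x = (x + 1) * pochhammer (x + \<alpha> + 2) m" for x
    by (simp add: p_def poly_poch_poly algebra_simps)
  have deg_p: "degree p = Suc m"
    unfolding p_def by (subst degree_mult_eq) (auto simp: poch_poly_def degree_prod_linear)
  have h: "(\<lambda>k. c k * (poly p (s j) / (s j + (\<alpha> + 2 + real k)))) sums
      (Gamma (- \<alpha>) * (Gamma (s j + \<alpha> + real (Suc m) + 1) / Gamma (s j + 1)))" for j
  proof -
    define x where "x = s j"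
    have x: "x > -1"
      unfolding x_def by (rule node_gt)
    have "(\<lambda>k. pochhammer (1 - (- \<alpha>)) k / (fact k * (x + \<alpha> + 2 + real k))) sums Beta (x + \<alpha> + 2) (- \<alpha>)"
      using \<alpha> x by (intro Beta_series) auto
    then have "(\<lambda>k. poly p x * (c k / (x + \<alpha> + 2 + real k))) sums (poly p x * Beta (x + \<alpha> + 2) (- \<alpha>))"
      by (intro sums_mult) (simp add: c_def)
    moreover have "poly p x * Beta (x + \<alpha> + 2) (- \<alpha>) =
        Gamma (- \<alpha>) * (Gamma (x + \<alpha> + real (Suc m) + 1) / Gamma (x + 1))"
    proof -
      have "Gamma (x + 1 + 1) = (x + 1) * Gamma (x + 1)"
        using x by (intro Gamma_plus1) (auto elim!: nonpos_Ints_cases)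
      then have G: "Gamma (x + 2) = (x + 1) * Gamma (x + 1)"
        by (simp add: add_ac)
      have "Gamma (x + \<alpha> + 2 + real m) / Gamma (x + \<alpha> + 2) = pochhammer (x + \<alpha> + 2) m"
        using \<alpha> x by (intro Gamma_ratio_real) auto
      moreover have "Gamma (x + \<alpha> + 2) > 0" "Gamma (x + 1) > 0"
        using \<alpha> x by auto
      ultimately have P: "Gamma (x + \<alpha> + real (Suc m) + 1) = Gamma (x + \<alpha> + 2) * pochhammer (x + \<alpha> + 2) m"
        by (simp add: field_simps)
      have "Beta (x + \<alpha> + 2) (- \<alpha>) = Gamma (x + \<alpha> + 2) * Gamma (- \<alpha>) / Gamma (x + 2)"
        by (simp add: Beta_def)
      moreover have "y * P * (g * h / (y * l)) = h * (g * P / l)" if "y \<noteq> 0" for y P g h l :: real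
        using that by simp
      ultimately show ?thesis
        using x unfolding P poly_p G by simp
    qed
    ultimately show ?thesis
      by (simp add: x_def add_ac mult_ac)
  qed
  define f where "f k = c k * divdiff s (\<lambda>x. poly p x / (x + (\<alpha> + 2 + real k))) {..Suc m}" for k
  have "(\<lambda>k. \<Sum>j\<le>Suc m. c k * (poly p (s j) / (s j + (\<alpha> + 2 + real k))) / (\<Prod>i\<in>{..Suc m} - {j}. s j - s i)) sums
      (\<Sum>j\<le>Suc m. Gamma (- \<alpha>) * (Gamma (s j + \<alpha> + real (Suc m) + 1) / Gamma (s j + 1)) / (\<Prod>i\<in>{..Suc m} - {j}. s j - s i))"
    by (intro sums_sum sums_divide h)
  then have f_sums: "f sums (Gamma (- \<alpha>) * gamma_divdiff \<alpha> (Suc m))"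
    by (simp add: f_def[abs_def] gamma_divdiff_def divdiff_def sum_distrib_left del: sum.atMost_Suc)
  have f_eq: "f k = c k * ((-1) ^ Suc m * poly p (- (\<alpha> + 2 + real k)) / (\<Prod>i\<le>Suc m. s i + (\<alpha> + 2 + real k)))" for k
  proof -
    have "s i + (\<alpha> + 2 + real k) \<noteq> 0" for i
      using node_gt[of i] \<alpha> by (smt (verit) of_nat_0_le_iff)
    then show ?thesis
      unfolding f_def by (subst divdiff_poly_over_linear) (simp_all add: inj_on_node deg_p)
  qed
  have poly_p_neg: "poly p (- (\<alpha> + 2 + real k)) = - (1 + \<alpha> + real k) * pochhammer (- real k) m" for k
    by (simp add: poly_p)
  \<comment> \<open>The Pochhammer factor vanishes at the first \<open>m\<close> poles, so the series effectively starts at \<open>k = m\<close>.\<close>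
  have "f i = 0" if "i < m" for i
    unfolding f_eq poly_p_neg using that by (simp add: pochhammer_of_nat_eq_0_lemma)
  then have "(\<lambda>k. f (k + m)) sums (Gamma (- \<alpha>) * gamma_divdiff \<alpha> (Suc m))"
    using f_sums by (subst sums_zero_iff_shift) auto
  moreover have "f (k + m) = gd_term \<alpha> (Suc m) k" for k
  proof -
    have "pochhammer (- real (k + m)) m = (-1) ^ m * pochhammer (real k + 1) m"
      by (subst pochhammer_minus) simp
    moreover have "fact (k + m) = fact k * pochhammer (real k + 1) m"
      using pochhammer_product'[of "1::real" k m] by (simp add: pochhammer_fact add_ac)
    moreover have "pochhammer (real k + 1) m > 0"
      by (intro pochhammer_pos) simp
    moreover have "pochhammer (1 + \<alpha>) (k + Suc m) = pochhammer (1 + \<alpha>) (k + m) * (1 + \<alpha> + real (k + m))"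
      by (simp add: pochhammer_Suc)
    moreover have "(\<Prod>i\<le>Suc m. s i + (\<alpha> + 2 + real (k + m))) = (\<Prod>i\<le>Suc m. s i + 1 + \<alpha> + real k + real (Suc m))"
      by (intro prod.cong) auto
    moreover have "N / (F * P) * ((-1) ^ Suc m * (- u * ((-1) ^ m * P)) / Q) = N * u / (F * Q)"
      if "P > 0" for N F P u Q :: real
      using that by (cases "even m") simp_all
    ultimately show ?thesis
      unfolding f_eq poly_p_neg gd_term_def c_def by (simp only:)
  qed
  ultimately show ?thesis
    by simp
qed

lemma gd_term_factor_pos:
  assumes "-1 < \<alpha>"
  shows "s i + 1 + \<alpha> + real k + real (Suc m) > 0"
  using node_gt[of i] assms by (smt (verit) of_nat_0_le_iff of_nat_Suc)

lemma gd_term_pos: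
  assumes "-1 < \<alpha>"
  shows "gd_term \<alpha> (Suc m) k > 0"
  unfolding gd_term_def using assms gd_term_factor_pos[OF assms]
  by (intro divide_pos_pos mult_pos_pos pochhammer_pos prod_pos) auto

lemma gamma_divdiff_pos_neg_param:
  assumes "-1 < \<alpha>" "\<alpha> < 0"
  shows "gamma_divdiff \<alpha> (Suc m) > 0"
proof -
  have "Gamma (- \<alpha>) * gamma_divdiff \<alpha> (Suc m) > 0"
    using gd_term_sums[OF assms] gd_term_pos[OF assms(1)]
    by (metis sums_iff suminf_pos)
  moreover have "Gamma (- \<alpha>) > 0"
    using assms by (intro Gamma_real_pos) auto
  ultimately show ?thesis
    by (simp add: zero_less_mult_iff)
qed

text \<open>
  Passing from \<open>n\<close> to \<open>n + 1\<close> shifts the series by one place and damps it by a factor that is close to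
  1 only for indices much larger than \<open>n\<close>.
\<close>

lemma gd_term_Suc:
  "gd_term \<alpha> (Suc n) k = gd_term \<alpha> n (Suc k) * (real (Suc k) / (s (Suc n) + \<alpha> + real n + 1 + real (Suc k)))"
proof -
  have "(\<Prod>i\<le>Suc n. s i + 1 + \<alpha> + real k + real (Suc n)) =
      (\<Prod>i\<le>n. s i + 1 + \<alpha> + real (Suc k) + real n) * (s (Suc n) + \<alpha> + real n + 1 + real (Suc k))"
    by (simp add: add_ac)
  then show ?thesis
    by (simp add: gd_term_def)
qed

text \<open>
  The factors of \<open>real k * gd_term \<alpha> n k\<close> other than \<open>pochhammer (1 + \<alpha>) (k + n) / fact (k + n)\<close> can be
  paired into \<open>n + 1\<close> quotients tending to 1.
\<close>

lemma gd_term_decay: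
  assumes "\<alpha> < 0"
  shows "(\<lambda>k. real k * gd_term \<alpha> n k) \<longlonglongrightarrow> 0"
proof -
  have "(\<lambda>k. pochhammer (1 + \<alpha>) (k + n) / fact (k + n) *
      (\<Prod>i\<le>n. (real k + real i) / (s i + 1 + \<alpha> + real k + real n))) \<longlonglongrightarrow> 0 * (\<Prod>i\<le>n. 1)"
  proof (intro tendsto_mult tendsto_prod)
    show "(\<lambda>k. pochhammer (1 + \<alpha>) (k + n) / fact (k + n)) \<longlonglongrightarrow> 0"
      using LIMSEQ_ignore_initial_segment[OF pochhammer_over_fact_tendsto_0[OF assms]] .
    show "(\<lambda>k. (real k + real i) / (s i + 1 + \<alpha> + real k + real n)) \<longlonglongrightarrow> 1" for i
      by real_asymp
  qed
  moreover have "pochhammer (1 + \<alpha>) (k + n) / fact (k + n) *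
      (\<Prod>i\<le>n. (real k + real i) / (s i + 1 + \<alpha> + real k + real n)) = real k * gd_term \<alpha> n k" for k
  proof -
    have "(\<Prod>i\<le>n. real k + real i) = pochhammer (real k) (Suc n)"
      by (simp add: pochhammer_Suc_prod atLeast0AtMost)
    also have "\<dots> = real k * pochhammer (real k + 1) n"
      by (simp add: pochhammer_rec)
    finally have P: "(\<Prod>i\<le>n. real k + real i) = real k * pochhammer (real k + 1) n" .
    have F: "fact (k + n) = fact k * pochhammer (real k + 1) n"
      using pochhammer_product'[of "1::real" k n] by (simp add: pochhammer_fact add_ac)
    have "pochhammer (real k + 1) n > 0"
      by (intro pochhammer_pos) simp
    then show ?thesis
      by (simp add: prod_dividef P F gd_term_def)
  qed
  ultimately show ?thesis
    by simp
qed

definition node_sum :: "nat \<Rightarrow> real" where "node_sum n = (\<Sum>i\<le>n. s i)"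

text \<open>
  The quotient of consecutive terms is a product over the nodes, bounded below by the Weierstrass
  inequality \<open>\<Prod>(1 - x) \<ge> 1 - \<Sum>x\<close>. If all nodes were zero, the resulting bound would be \<open>\<alpha>\<close>. The
  positive nodes contribute their sum, which grows like \<open>n ^ 2\<close>, divided by a quantity of order
  \<open>n + k\<close>; the two nodes that may be negative cost at most 2.
\<close>

lemma gd_term_increment:
  fixes \<alpha> :: real
  assumes \<alpha>: "-1 < \<alpha>" and n: "n = Suc m"
  shows "real (Suc k) * gd_term \<alpha> n (Suc k) - real k * gd_term \<alpha> n k
    \<ge> gd_term \<alpha> n k * (\<alpha> - 2 + node_sum n / (s (Suc n) + \<alpha> + real n + 3 + real k))"
proof -
  define A where "A = real n + real k + 2 + \<alpha>"
  define M where "M = s (Suc n) + \<alpha> + real n + 3 + real k"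
  have A: "A > 1"
    using \<alpha> n by (simp add: A_def)
  have A_node: "A + s i > 1" for i
    using node_gt[of i] \<alpha> n by (simp add: A_def)
  have A_node_le: "A + s i \<le> M" if "i \<le> n" for i
    using node_mono[of i "Suc n"] that by (simp add: A_def M_def)
  have M: "M > 1"
    using A_node[of 0] A_node_le[of 0] by simp
  have factor: "s i + 1 + \<alpha> + real k + real n > 0" for i
    unfolding n by (rule gd_term_factor_pos[OF \<alpha>])
  have shift: "s i + 1 + \<alpha> + real k + real n = A + s i - 1"
      "s i + 1 + \<alpha> + real (Suc k) + real n = A + s i" for i
    by (simp_all add: A_def)
  have quot: "real (Suc k) * gd_term \<alpha> n (Suc k) =
      gd_term \<alpha> n k * ((A - 1) * (\<Prod>i\<le>n. 1 - 1 / (A + s i)))"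
  proof -
    have "(\<Prod>i\<le>n. 1 - 1 / (A + s i)) = (\<Prod>i\<le>n. (A + s i - 1) / (A + s i))"
      using A_node by (intro prod.cong refl) (smt (verit) diff_divide_distrib divide_self)
    also have "\<dots> = (\<Prod>i\<le>n. A + s i - 1) / (\<Prod>i\<le>n. A + s i)"
      by (rule prod_dividef)
    finally have P: "(\<Prod>i\<le>n. 1 - 1 / (A + s i)) = (\<Prod>i\<le>n. A + s i - 1) / (\<Prod>i\<le>n. A + s i)" .
    have "pochhammer (1 + \<alpha>) (Suc k + n) = pochhammer (1 + \<alpha>) (k + n) * (A - 1)"
      by (simp add: pochhammer_Suc A_def)
    moreover have "(\<Prod>i\<le>n. A + s i - 1) \<noteq> 0"
      using A_node by (smt (verit) finite_atMost prod_zero_iff)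
    moreover have "(\<Prod>i\<le>n. A + s i) \<noteq> 0"
      using A_node by (smt (verit) finite_atMost prod_zero_iff)
    moreover have "real (Suc k) * (x / (fact (Suc k) * y)) = x / (fact k * y)" for x y
      by (simp del: of_nat_Suc)
    ultimately show ?thesis
      unfolding gd_term_def shift P by (simp del: of_nat_Suc)
  qed
  have prod_ge: "(\<Prod>i\<le>n. 1 - 1 / (A + s i)) \<ge> 1 - (\<Sum>i\<le>n. 1 / (A + s i))"
  proof (rule Weierstrass_prod_ineq)
    fix i
    show "1 / (A + s i) \<in> {0..1}"
      using A_node[of i] by auto
  qed
  define \<sigma> where "\<sigma> = (\<Sum>i\<le>n. 1 / (A + s i))"
  have "\<sigma> \<ge> 0"
    unfolding \<sigma>_def using A_node by (intro sum_nonneg) (smt (verit) divide_nonneg_nonneg)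
  have A_sigma: "A * \<sigma> = real n + 1 - (\<Sum>i\<le>n. s i / (A + s i))"
  proof -
    have "A * \<sigma> = (\<Sum>i\<le>n. 1 - s i / (A + s i))"
      unfolding \<sigma>_def sum_distrib_left
    proof (rule sum.cong[OF refl])
      fix i
      show "A * (1 / (A + s i)) = 1 - s i / (A + s i)"
        using A_node[of i] by (simp add: divide_simps)
    qed
    then show ?thesis
      by (simp add: sum_subtractf)
  qed
  have sum_ge: "(\<Sum>i\<le>n. s i / (A + s i)) \<ge> node_sum n / M - 2"
  proof -
    have "s i / (A + s i) \<ge> s i / M - (if i < 2 then 1 else 0)" if "i \<le> n" for i
    proof (cases "s i \<ge> 0")
      case True
      then have "s i / M \<le> s i / (A + s i)"
        using A_node[of i] A_node_le[OF that] by (intro divide_left_mono) auto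
      then show ?thesis
        by simp
    next
      case False
      then have "i < 2"
        using node_pos[of i] by force
      moreover have "s i / (A + s i) \<ge> -1"
        using A_node[of i] node_gt[of i] by (simp add: divide_simps)
      moreover have "s i / M \<le> 0"
        using False M by (simp add: divide_nonpos_pos)
      ultimately show ?thesis
        by simp
    qed
    then have "(\<Sum>i\<le>n. s i / (A + s i)) \<ge> (\<Sum>i\<le>n. s i / M - (if i < 2 then 1 else 0))"
      by (intro sum_mono) auto
    moreover have "(\<Sum>i\<le>n. if i < 2 then 1 else (0::real)) = real (card ({..n} \<inter> {..<2}))"
      by (simp add: sum.If_cases lessThan_def)
    moreover have "card ({..n} \<inter> {..<2}) \<le> card {..<2::nat}"
      by (intro card_mono) auto
    ultimately show ?thesis
      by (simp add: sum_subtractf node_sum_def sum_divide_distrib)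
  qed
  have "(A - 1) * (\<Prod>i\<le>n. 1 - 1 / (A + s i)) - real k \<ge> (A - 1) * (1 - \<sigma>) - real k"
    using prod_ge A by (simp add: \<sigma>_def mult_left_mono)
  also have "(A - 1) * (1 - \<sigma>) - real k \<ge> A - 1 - A * \<sigma> - real k"
    using \<open>\<sigma> \<ge> 0\<close> by (simp add: algebra_simps)
  also have "A - 1 - A * \<sigma> - real k \<ge> \<alpha> - 2 + node_sum n / M"
    using sum_ge by (simp add: A_sigma) (simp add: A_def)
  finally have "gd_term \<alpha> n k * (\<alpha> - 2 + node_sum n / M) \<le>
      gd_term \<alpha> n k * ((A - 1) * (\<Prod>i\<le>n. 1 - 1 / (A + s i)) - real k)"
    using gd_term_pos[OF \<alpha>, of m k] n by (intro mult_left_mono) auto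
  then show ?thesis
    unfolding quot M_def by (simp add: algebra_simps)
qed

text \<open>
  The increments of \<open>k * t k\<close> add up to zero. Their lower bound therefore limits the sum of
  \<open>t k / (A + 2 + k)\<close> to a multiple of the total divided by the sum of the nodes, while the defect of
  the ratio is at most \<open>3 * A\<close> times that sum.
\<close>

lemma gamma_divdiff_ratio_bounds:
  assumes \<alpha>: "-1 < \<alpha>" "\<alpha> < 0" and S: "node_sum n > 0" and n: "n \<ge> 2"
  defines "A \<equiv> s (Suc n) + \<alpha> + real n + 1"
  shows "gamma_divdiff \<alpha> (Suc n) / gamma_divdiff \<alpha> n \<le> 1"
    and "gamma_divdiff \<alpha> (Suc n) / gamma_divdiff \<alpha> n \<ge> 1 - 3 * A * (2 - \<alpha>) / node_sum n"
proof -
  obtain m where m: "n = Suc m"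
    using n by (cases n) auto
  define t where "t = gd_term \<alpha> n"
  define G where "G = Gamma (- \<alpha>)"
  have A: "A > 1"
    using node_gt[of "Suc n"] \<alpha> n by (simp add: A_def)
  have G: "G > 0"
    unfolding G_def using \<alpha> by (intro Gamma_real_pos) auto
  have t_sums: "t sums (G * gamma_divdiff \<alpha> n)"
    unfolding t_def G_def m by (rule gd_term_sums[OF \<alpha>])
  have t_pos: "t k > 0" for k
    unfolding t_def m by (rule gd_term_pos[OF \<alpha>(1)])
  have D_pos: "gamma_divdiff \<alpha> n > 0"
    unfolding m by (rule gamma_divdiff_pos_neg_param[OF \<alpha>])
  have "(\<lambda>k. t (Suc k) * (real (Suc k) / (A + real (Suc k)))) sums (G * gamma_divdiff \<alpha> (Suc n))"
    using gd_term_sums[OF \<alpha>, of n] unfolding t_def G_def A_def gd_term_Suc[abs_def] .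
  \<comment> \<open>The term for \<open>k = 0\<close> is zero, so the shifted series may be started there.\<close>
  then have next_sums: "(\<lambda>k. t k * (real k / (A + real k))) sums (G * gamma_divdiff \<alpha> (Suc n))"
    by (subst (asm) sums_Suc_iff) simp
  have defect: "(\<lambda>k. t k * (A / (A + real k))) sums (G * gamma_divdiff \<alpha> n - G * gamma_divdiff \<alpha> (Suc n))"
  proof -
    have "t k - t k * (real k / (A + real k)) = t k * (A / (A + real k))" for k
      using A by (simp add: divide_simps) (simp add: algebra_simps)
    then show ?thesis
      using sums_diff[OF t_sums next_sums] by simp
  qed
  have summable_M: "summable (\<lambda>k. t k * (1 / (A + 2 + real k)))"
  proof (rule summable_comparison_test')
    show "summable t"
      using t_sums by (rule sums_summable)
    fix k
    have "1 / (A + 2 + real k) \<le> 1"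
      using A by simp
    then have "t k * (1 / (A + 2 + real k)) \<le> t k * 1"
      using t_pos[of k] by (intro mult_left_mono) auto
    then show "norm (t k * (1 / (A + 2 + real k))) \<le> t k"
      using t_pos[of k] A by simp
  qed
  define R where "R = (\<Sum>k. t k * (1 / (A + 2 + real k)))"
  have R_sums: "(\<lambda>k. t k * (1 / (A + 2 + real k))) sums R"
    unfolding R_def using summable_M by (rule summable_sums)
  have "(\<lambda>k. real (Suc k) * t (Suc k) - real k * t k) sums (0 - real 0 * t 0)"
    unfolding t_def by (intro telescope_sums gd_term_decay \<alpha>)
  then have tele: "(\<lambda>k. real (Suc k) * t (Suc k) - real k * t k) sums 0"
    by simp
  have low: "(\<lambda>k. (\<alpha> - 2) * t k + node_sum n * (t k * (1 / (A + 2 + real k)))) sums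
      ((\<alpha> - 2) * (G * gamma_divdiff \<alpha> n) + node_sum n * R)"
    by (intro sums_add sums_mult t_sums R_sums)
  have "(\<alpha> - 2) * (G * gamma_divdiff \<alpha> n) + node_sum n * R \<le> 0"
  proof (rule sums_le[OF _ low tele])
    fix k
    show "(\<alpha> - 2) * t k + node_sum n * (t k * (1 / (A + 2 + real k))) \<le>
        real (Suc k) * t (Suc k) - real k * t k"
      using gd_term_increment[OF \<alpha>(1) m, of k] unfolding t_def A_def
      by (simp add: algebra_simps)
  qed
  then have R_le: "R \<le> (2 - \<alpha>) * (G * gamma_divdiff \<alpha> n) / node_sum n"
    using S by (simp add: field_simps)
  have "G * gamma_divdiff \<alpha> n - G * gamma_divdiff \<alpha> (Suc n) \<le> 3 * A * R"
  proof (rule sums_le[OF _ defect sums_mult[OF R_sums]])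
    fix k
    have "A / (A + real k) \<le> 3 * A * (1 / (A + 2 + real k))"
      using A by (simp add: divide_simps)
    then have "t k * (A / (A + real k)) \<le> t k * (3 * A * (1 / (A + 2 + real k)))"
      using t_pos[of k] by (intro mult_left_mono) auto
    then show "t k * (A / (A + real k)) \<le> 3 * A * (t k * (1 / (A + 2 + real k)))"
      by (simp add: mult_ac)
  qed
  also have "\<dots> \<le> 3 * A * ((2 - \<alpha>) * (G * gamma_divdiff \<alpha> n) / node_sum n)"
    using R_le A by (intro mult_left_mono) auto
  finally have "G * (gamma_divdiff \<alpha> n - gamma_divdiff \<alpha> (Suc n)) \<le> G * (3 * A * (2 - \<alpha>) / node_sum n * gamma_divdiff \<alpha> n)"
    by (simp add: algebra_simps)
  then have "gamma_divdiff \<alpha> n - gamma_divdiff \<alpha> (Suc n) \<le> 3 * A * (2 - \<alpha>) / node_sum n * gamma_divdiff \<alpha> n"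
    using G by (simp only: mult_le_cancel_left_pos)
  then have "(1 - 3 * A * (2 - \<alpha>) / node_sum n) * gamma_divdiff \<alpha> n \<le> gamma_divdiff \<alpha> (Suc n)"
    by (simp only: left_diff_distrib mult_1_left)
  then show "gamma_divdiff \<alpha> (Suc n) / gamma_divdiff \<alpha> n \<ge> 1 - 3 * A * (2 - \<alpha>) / node_sum n"
    using D_pos by (simp only: pos_le_divide_eq)
  have "0 \<le> G * gamma_divdiff \<alpha> n - G * gamma_divdiff \<alpha> (Suc n)"
  proof (rule sums_le[OF _ sums_zero defect])
    fix k
    show "0 \<le> t k * (A / (A + real k))"
      using t_pos[of k] A by simp
  qed
  then have "0 \<le> G * (gamma_divdiff \<alpha> n - gamma_divdiff \<alpha> (Suc n))"
    by (simp add: algebra_simps)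
  then show "gamma_divdiff \<alpha> (Suc n) / gamma_divdiff \<alpha> n \<le> 1"
    using G D_pos by (simp add: zero_le_mult_iff)
qed

lemma node_sum_lower: "node_sum n \<ge> (real n + 1) * (real n - 6) / 4"
proof -
  have "(\<Sum>i\<le>n. real i / 2 - 3 / 2) \<le> node_sum n"
    unfolding node_sum_def by (intro sum_mono node_lower)
  moreover have "(\<Sum>i\<le>n. real i / 2 - 3 / 2) = (real n + 1) * (real n - 6) / 4"
    by (induction n) (simp_all add: field_simps)
  ultimately show ?thesis
    by simp
qed

text \<open>
  In the bounds, \<open>A\<close> grows linearly and the sum of the nodes quadratically.
\<close>

lemma gamma_divdiff_ratio_neg_param:
  assumes \<alpha>: "-1 < \<alpha>" "\<alpha> < 0"
  shows "(\<lambda>n. gamma_divdiff \<alpha> (Suc n) / gamma_divdiff \<alpha> n) \<longlonglongrightarrow> 1"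
proof (rule tendsto_sandwich)
  define K where "K = \<bar>a\<bar> + \<bar>b\<bar>"
  have bound: "1 - 3 * (real (Suc n) / 2 + K + \<alpha> + real n + 1) * (2 - \<alpha>) / ((real n + 1) * (real n - 6) / 4)
      \<le> gamma_divdiff \<alpha> (Suc n) / gamma_divdiff \<alpha> n \<and> gamma_divdiff \<alpha> (Suc n) / gamma_divdiff \<alpha> n \<le> 1" if n: "n > 6" for n
  proof -
    define L where "L = (real n + 1) * (real n - 6) / 4"
    have L: "L > 0" "L \<le> node_sum n"
      using n node_sum_lower[of n] by (auto simp: L_def)
    have K: "s (Suc n) \<le> real (Suc n) / 2 + K"
      using node_upper[of "Suc n"] by (simp add: K_def)
    have A0: "s (Suc n) + \<alpha> + real n + 1 > 0"
      using node_gt[of "Suc n"] \<alpha> n by simp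
    have "3 * (s (Suc n) + \<alpha> + real n + 1) * (2 - \<alpha>) / node_sum n \<le>
        3 * (real (Suc n) / 2 + K + \<alpha> + real n + 1) * (2 - \<alpha>) / L"
      using \<alpha> L A0 K by (intro frac_le mult_right_mono mult_left_mono mult_nonneg_nonneg) auto
    moreover have "2 \<le> n" "0 < node_sum n"
      using n L by auto
    ultimately show ?thesis
      using gamma_divdiff_ratio_bounds[OF \<alpha>, of n] unfolding L_def by fastforce
  qed
  show "\<forall>\<^sub>F n in sequentially. 1 - 3 * (real (Suc n) / 2 + K + \<alpha> + real n + 1) * (2 - \<alpha>) / ((real n + 1) * (real n - 6) / 4)
      \<le> gamma_divdiff \<alpha> (Suc n) / gamma_divdiff \<alpha> n"
    using eventually_gt_at_top[of 6] by eventually_elim (use bound in blast)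
  show "\<forall>\<^sub>F n in sequentially. gamma_divdiff \<alpha> (Suc n) / gamma_divdiff \<alpha> n \<le> 1"
    using eventually_gt_at_top[of 6] by eventually_elim (use bound in blast)
  show "(\<lambda>n. 1 - 3 * (real (Suc n) / 2 + K + \<alpha> + real n + 1) * (2 - \<alpha>) / ((real n + 1) * (real n - 6) / 4)) \<longlonglongrightarrow> 1"
    by real_asymp
qed simp

text \<open>
  Induction on an integer bound for \<open>\<alpha>\<close>, with the recursion in \<open>\<alpha>\<close> as the induction step. At \<open>n = 0\<close> the
  sign is not under control for negative \<open>\<alpha>\<close>, where \<open>s 0 + \<alpha> + 1\<close> may be negative or zero.
\<close>

lemma gamma_divdiff_pos_and_ratio:
  assumes "-1 < \<alpha>"
  shows "(\<forall>n. gamma_divdiff \<alpha> (Suc n) > 0) \<and> (\<lambda>n. gamma_divdiff \<alpha> (Suc n) / gamma_divdiff \<alpha> n) \<longlonglongrightarrow> 1"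
proof -
  have "\<forall>\<alpha>. -1 < \<alpha> \<and> \<alpha> \<le> real m \<longrightarrow>
      (\<forall>n. gamma_divdiff \<alpha> (Suc n) > 0) \<and> (\<lambda>n. gamma_divdiff \<alpha> (Suc n) / gamma_divdiff \<alpha> n) \<longlonglongrightarrow> 1" for m
  proof (induction m)
    case 0
    show ?case
      using gamma_divdiff_pos_neg_param gamma_divdiff_ratio_neg_param by (auto simp: gamma_divdiff_zero le_less)
  next
    case (Suc m)
    show ?case
    proof (intro allI impI)
      fix \<alpha> :: real assume \<alpha>: "-1 < \<alpha> \<and> \<alpha> \<le> real (Suc m)"
      show "(\<forall>n. gamma_divdiff \<alpha> (Suc n) > 0) \<and> (\<lambda>n. gamma_divdiff \<alpha> (Suc n) / gamma_divdiff \<alpha> n) \<longlonglongrightarrow> 1"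
      proof (cases "\<alpha> \<le> real m")
        case True
        then show ?thesis
          using Suc.IH \<alpha> by blast
      next
        case False
        then have \<alpha>_pos: "\<alpha> > 0"
          by (smt (verit) of_nat_0_le_iff)
        have IH: "\<And>n. gamma_divdiff (\<alpha> - 1) (Suc n) > 0" "(\<lambda>n. gamma_divdiff (\<alpha> - 1) (Suc n) / gamma_divdiff (\<alpha> - 1) n) \<longlonglongrightarrow> 1"
          using Suc.IH \<alpha> \<alpha>_pos by auto
        define A where "A n = s (Suc n) + \<alpha> + real n + 1" for n
        define w where "w n = A n * gamma_divdiff (\<alpha> - 1) (Suc n)" for n
        have A_pos: "A n > 0" for n
          using node_gt[of "Suc n"] \<alpha>_pos by (simp add: A_def add_pos_pos add_nonneg_pos)
        have w_pos: "w n > 0" for n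
          using A_pos IH(1) by (simp add: w_def)
        have D0: "gamma_divdiff \<alpha> 0 > 0"
          unfolding gamma_divdiff_0 using node_gt[of 0] \<alpha>_pos by (intro divide_pos_pos Gamma_real_pos) auto
        have D_Suc: "gamma_divdiff \<alpha> (Suc n) = gamma_divdiff \<alpha> n + w n" for n
          using gamma_divdiff_rec[of \<alpha> n] \<alpha>_pos by (simp add: w_def A_def)
        have "(\<lambda>n. A (Suc n) / A n) \<longlonglongrightarrow> 1"
        proof -
          have "(\<lambda>n. A n / real n) \<longlonglongrightarrow> 3 / 2"
          proof -
            have "(\<lambda>n. s (Suc n) / real (Suc n) * (real (Suc n) / real n) + (\<alpha> + real n + 1) / real n) \<longlonglongrightarrow> 1 / 2 * 1 + 1"
            proof (rule tendsto_add[OF tendsto_mult[OF LIMSEQ_Suc[OF node_over_n]]])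
              show "(\<lambda>n. real (Suc n) / real n) \<longlonglongrightarrow> 1" "(\<lambda>n. (\<alpha> + real n + 1) / real n) \<longlonglongrightarrow> 1"
                by real_asymp+
            qed
            moreover have "s (Suc n) / real (Suc n) * (real (Suc n) / real n) + (\<alpha> + real n + 1) / real n = A n / real n" for n
              by (simp add: A_def add_divide_distrib del: of_nat_Suc)
            ultimately show ?thesis
              by simp
          qed
          note lim = this
          have "(\<lambda>n. (A (Suc n) / real (Suc n)) / (A n / real n) * (real (Suc n) / real n)) \<longlonglongrightarrow> (3/2) / (3/2) * 1"
          proof (rule tendsto_mult[OF tendsto_divide[OF LIMSEQ_Suc[OF lim] lim]])
            show "(\<lambda>n. real (Suc n) / real n) \<longlonglongrightarrow> 1"
              by real_asymp
          qed simp
          moreover have "\<forall>\<^sub>F n in sequentially. (A (Suc n) / real (Suc n)) / (A n / real n) * (real (Suc n) / real n) = A (Suc n) / A n"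
            using eventually_gt_at_top[of 0] by eventually_elim (simp del: of_nat_Suc)
          ultimately have "(\<lambda>n. A (Suc n) / A n) \<longlonglongrightarrow> (3/2) / (3/2) * 1"
            by (rule Lim_transform_eventually)
          then show ?thesis
            by simp
        qed
        from tendsto_mult[OF this LIMSEQ_Suc[OF IH(2)]]
        have "(\<lambda>n. w (Suc n) / w n) \<longlonglongrightarrow> 1"
          by (simp add: w_def)
        then have "(\<lambda>n. gamma_divdiff \<alpha> (Suc n) / gamma_divdiff \<alpha> n) \<longlonglongrightarrow> 1"
          by (rule partial_sums_ratio[OF w_pos _ D0 D_Suc])
        moreover have "gamma_divdiff \<alpha> n > 0" for n
          by (induction n) (use D0 D_Suc w_pos in \<open>auto intro: add_pos_pos\<close>)
        ultimately show ?thesis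
          by blast
      qed
    qed
  qed
  moreover obtain m :: nat where "\<alpha> \<le> real m"
    using real_arch_simple by blast
  ultimately show ?thesis
    using assms by blast
qed

end

section \<open>The Mellin transform with respect to the Jacobi-Pineiro measure\<close>

locale jacobi_pineiro = jp_nodes \<alpha>1 \<alpha>2 for \<alpha>1 \<alpha>2 :: real +
  fixes \<alpha>0 :: real
  assumes \<alpha>0: "\<alpha>0 > -1"
begin

abbreviation \<mu> :: "real measure" where "\<mu> \<equiv> jp_measure \<alpha>0"

lemma space_jp_measure: "space \<mu> = {0..1}"
  by (simp add: jp_measure_def space_restrict_space)

lemma jp_measure_density:
  fixes f :: "real \<Rightarrow> real"
  assumes [measurable]: "f \<in> borel_measurable borel"
  shows "integrable \<mu> f \<longleftrightarrow> set_integrable lborel {0..1} (\<lambda>x. f x * (1 - x) powr \<alpha>0)"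
    and "integral\<^sup>L \<mu> f = (LINT x:{0..1}|lborel. f x * (1 - x) powr \<alpha>0)"
  unfolding jp_measure_def set_integrable_def set_lebesgue_integral_def
  by (subst integrable_density integral_density;
      (intro measurable_restrict_space1; measurable)?;
      simp add: integrable_restrict_space integral_restrict_space mult_ac)+

lemma moment:
  assumes "\<sigma> > -1"
  shows "integrable \<mu> (\<lambda>x. x powr \<sigma>)" "(LINT x|\<mu>. x powr \<sigma>) = Beta (\<sigma> + 1) (\<alpha>0 + 1)"
proof -
  have int: "set_integrable lborel {0..1} (\<lambda>x. x powr \<sigma> * (1 - x) powr \<alpha>0)"
    using integrable_Beta[of "\<sigma> + 1" "\<alpha>0 + 1"] assms \<alpha>0 by simp
  then show "integrable \<mu> (\<lambda>x. x powr \<sigma>)"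
    by (subst jp_measure_density) auto
  have "(LINT x:{0..1}|lborel. x powr \<sigma> * (1 - x) powr \<alpha>0) =
      integral {0..1} (\<lambda>x. x powr \<sigma> * (1 - x) powr \<alpha>0)"
    using int by (rule set_borel_integral_eq_integral)
  also have "\<dots> = Beta (\<sigma> + 1) (\<alpha>0 + 1)"
    using has_integral_Beta_real[of "\<sigma> + 1" "\<alpha>0 + 1"] assms \<alpha>0 by (intro integral_unique) simp
  finally show "(LINT x|\<mu>. x powr \<sigma>) = Beta (\<sigma> + 1) (\<alpha>0 + 1)"
    by (subst jp_measure_density) auto
qed

definition mellin :: "real poly \<Rightarrow> real \<Rightarrow> real" where
  "mellin p \<sigma> = (LINT x|\<mu>. poly p x * x powr \<sigma>)"

lemma mellin_integrable:
  assumes "\<sigma> > -1"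
  shows "integrable \<mu> (\<lambda>x. poly p x * x powr \<sigma>)"
proof -
  have "integrable \<mu> (\<lambda>x. \<Sum>i\<le>degree p. coeff p i * x powr (\<sigma> + real i))"
    using assms by (intro Bochner_Integration.integrable_sum integrable_mult_right moment) simp
  moreover have "(\<Sum>i\<le>degree p. coeff p i * x powr (\<sigma> + real i)) = poly p x * x powr \<sigma>"
    if "x \<in> space \<mu>" for x
    unfolding poly_altdef sum_distrib_right
    using that by (intro sum.cong refl; cases "x = 0") (auto simp: powr_add powr_realpow space_jp_measure)
  ultimately show ?thesis
    by (simp cong: Bochner_Integration.integrable_cong)
qed

lemma mellin_add: "\<sigma> > -1 \<Longrightarrow> mellin (p + q) \<sigma> = mellin p \<sigma> + mellin q \<sigma>"
  using mellin_integrable by (simp add: mellin_def distrib_right)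

lemma mellin_smult: "mellin (smult c p) \<sigma> = c * mellin p \<sigma>"
  by (simp add: mellin_def mult.assoc)

lemma mellin_0: "mellin 0 \<sigma> = 0"
  by (simp add: mellin_def)

lemma mellin_diff: "\<sigma> > -1 \<Longrightarrow> mellin (p - q) \<sigma> = mellin p \<sigma> - mellin q \<sigma>"
  using mellin_integrable by (simp add: mellin_def left_diff_distrib)

lemma mellin_sum: "\<sigma> > -1 \<Longrightarrow> mellin (\<Sum>i\<in>I. p i) \<sigma> = (\<Sum>i\<in>I. mellin (p i) \<sigma>)"
  by (induction I rule: infinite_finite_induct) (auto simp: mellin_add mellin_0)

lemma mellin_times_x: "mellin ([:0, 1:] * p) \<sigma> = mellin p (\<sigma> + 1)"
  unfolding mellin_def
proof (rule Bochner_Integration.integral_cong[OF refl])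
  fix x assume "x \<in> space \<mu>"
  then show "poly ([:0, 1:] * p) x * x powr \<sigma> = poly p x * x powr (\<sigma> + 1)"
    by (cases "x = 0") (auto simp: space_jp_measure powr_add)
qed

text \<open>
  The factor common to the transforms of all polynomials of degree at most \<open>n\<close>.
\<close>

definition mellin_factor :: "nat \<Rightarrow> real \<Rightarrow> real" where
  "mellin_factor n \<sigma> = Gamma (\<sigma> + 1) * Gamma (\<alpha>0 + 1) / Gamma (\<sigma> + real n + \<alpha>0 + 2)"

lemma mellin_factor_pos: "\<sigma> > -1 \<Longrightarrow> mellin_factor n \<sigma> > 0"
  unfolding mellin_factor_def using \<alpha>0 by (intro divide_pos_pos mult_pos_pos Gamma_real_pos) auto

lemma mellin_factor_Suc:
  assumes "\<sigma> > -1"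
  shows "mellin_factor n \<sigma> = mellin_factor (Suc n) \<sigma> * (\<sigma> + real n + \<alpha>0 + 2)"
proof -
  have pos: "\<sigma> + real n + \<alpha>0 + 2 > 0"
    using assms \<alpha>0 by simp
  then have "Gamma (\<sigma> + real n + \<alpha>0 + 2 + 1) = (\<sigma> + real n + \<alpha>0 + 2) * Gamma (\<sigma> + real n + \<alpha>0 + 2)"
    by (intro Gamma_plus1) (auto elim!: nonpos_Ints_cases)
  moreover have "Gamma (\<sigma> + real n + \<alpha>0 + 2 + 1) = Gamma (\<sigma> + real (Suc n) + \<alpha>0 + 2)"
    by (simp add: add_ac)
  ultimately show ?thesis
    using pos by (simp add: mellin_factor_def)
qed

lemma mellin_monom:
  assumes "\<sigma> > -1"
  shows "mellin (monom 1 n) \<sigma> = mellin_factor n \<sigma> * pochhammer (\<sigma> + 1) n"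
proof -
  have "mellin (monom 1 n) \<sigma> = (LINT x|\<mu>. x powr (\<sigma> + real n))"
    unfolding mellin_def
  proof (rule Bochner_Integration.integral_cong[OF refl])
    fix x assume "x \<in> space \<mu>"
    then show "poly (monom 1 n) x * x powr \<sigma> = x powr (\<sigma> + real n)"
      by (cases "x = 0") (auto simp: space_jp_measure powr_add powr_realpow poly_monom)
  qed
  also have "\<dots> = Beta (\<sigma> + real n + 1) (\<alpha>0 + 1)"
    using assms by (intro moment) simp
  also have "\<dots> = Gamma (\<sigma> + 1 + real n) * Gamma (\<alpha>0 + 1) / Gamma (\<sigma> + real n + \<alpha>0 + 2)"
    by (simp add: Beta_def add_ac)
  also have "Gamma (\<sigma> + 1 + real n) = Gamma (\<sigma> + 1) * pochhammer (\<sigma> + 1) n"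
  proof -
    have "Gamma (\<sigma> + 1) \<noteq> 0"
      using Gamma_real_pos[of "\<sigma> + 1"] assms by linarith
    then show ?thesis
      using Gamma_ratio_real[of "\<sigma> + 1" n] assms by (simp add: nonzero_divide_eq_eq mult.commute)
  qed
  finally show ?thesis
    by (simp add: mellin_factor_def)
qed

lemma poch_at_top_node: "pochhammer (1 - (real n + \<alpha>0 + 1)) n = (-1) ^ n * pochhammer (\<alpha>0 + 1) n"
  using pochhammer_minus[of "real n + \<alpha>0" n] by (simp add: add_ac)

text \<open>
  At \<open>\<sigma> = - (n + \<alpha>0 + 1)\<close> the polynomial parts of the transforms of \<open>1, x, \<dots>, x ^ (n - 1)\<close> vanish
  while that of \<open>x ^ n\<close> does not. So the value of \<open>P\<close> there determines the top coefficient, and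
  after subtracting the corresponding monomial one can divide by \<open>\<sigma> + n + \<alpha>0 + 1\<close> and continue with
  \<open>n - 1\<close>. The formula for \<open>poly p 1\<close> holds because each monomial contributes a monic Pochhammer
  polynomial.
\<close>

lemma mellin_surj:
  assumes "degree P \<le> n"
  shows "\<exists>p. degree p \<le> n \<and> (\<forall>\<sigma>>-1. mellin p \<sigma> = mellin_factor n \<sigma> * poly P \<sigma>) \<and>
    coeff p n = poly P (- (real n + \<alpha>0 + 1)) / ((-1) ^ n * pochhammer (\<alpha>0 + 1) n) \<and>
    poly p 1 = coeff P n"
  using assms
proof (induction n arbitrary: P)
  case 0
  then obtain c where c: "P = [:c:]"
    by (metis degree_eq_zeroE le_zero_eq)
  have "mellin [:c:] \<sigma> = mellin_factor 0 \<sigma> * c" if "\<sigma> > -1" for \<sigma>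
    using mellin_monom[OF that, of 0] mellin_smult[of c "monom 1 0" \<sigma>] by (simp add: monom_0)
  then show ?case
    by (intro exI[of _ "[:c:]"]) (auto simp: c)
next
  case (Suc n)
  define r where "r = - (real (Suc n) + \<alpha>0 + 1)"
  define z where "z = (-1) ^ Suc n * pochhammer (\<alpha>0 + 1) (Suc n)"
  define c where "c = poly P r / z"
  have "pochhammer (\<alpha>0 + 1) (Suc n) > 0"
    using \<alpha>0 by (intro pochhammer_pos) simp
  then have "z \<noteq> 0"
    by (simp add: z_def)
  have "pochhammer (r + 1) (Suc n) = z"
    using poch_at_top_node[of "Suc n"] unfolding r_def z_def by (simp add: algebra_simps)
  then have "poly (P - smult c (poch_poly 1 (Suc n))) r = 0"
    using \<open>z \<noteq> 0\<close> by (simp add: poly_poch_poly c_def)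
  then have "[:- r, 1:] dvd P - smult c (poch_poly 1 (Suc n))"
    by (simp only: poly_eq_0_iff_dvd)
  then obtain R where R: "P - smult c (poch_poly 1 (Suc n)) = [:- r, 1:] * R"
    by (rule dvdE)
  have deg: "degree (P - smult c (poch_poly 1 (Suc n))) \<le> Suc n"
    using Suc.prems degree_poch_poly[of 1 "Suc n"]
    by (intro degree_diff_le) (auto intro: order_trans[OF degree_smult_le])
  then have deg_R: "degree R \<le> n"
  proof (cases "R = 0")
    case False
    then have "degree ([:- r, 1:] * R) = Suc (degree R)"
      by (subst degree_mult_eq) auto
    then show ?thesis
      using deg R by simp
  qed simp
  from Suc.IH[OF this] obtain q where q: "degree q \<le> n" "\<And>\<sigma>. \<sigma> > -1 \<Longrightarrow> mellin q \<sigma> = mellin_factor n \<sigma> * poly R \<sigma>"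
      "poly q 1 = coeff R n"
    by blast
  have P: "P = [:- r, 1:] * R + smult c (poch_poly 1 (Suc n))"
    using R by (simp add: algebra_simps)
  define p where "p = q + monom c (Suc n)"
  have "mellin p \<sigma> = mellin_factor (Suc n) \<sigma> * poly P \<sigma>" if \<sigma>: "\<sigma> > -1" for \<sigma>
  proof -
    have "mellin p \<sigma> = mellin q \<sigma> + c * mellin (monom 1 (Suc n)) \<sigma>"
      using mellin_add[OF \<sigma>, of q "monom c (Suc n)"] mellin_smult[of c "monom 1 (Suc n)" \<sigma>]
      by (simp add: p_def smult_monom)
    also have "\<dots> = mellin_factor (Suc n) \<sigma> * ((\<sigma> - r) * poly R \<sigma> + c * pochhammer (\<sigma> + 1) (Suc n))"
      by (simp only: q(2)[OF \<sigma>] mellin_monom[OF \<sigma>] mellin_factor_Suc[OF \<sigma>, of n]) (simp add: r_def algebra_simps)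
    also have "(\<sigma> - r) * poly R \<sigma> + c * pochhammer (\<sigma> + 1) (Suc n) = poly P \<sigma>"
      by (subst P) (simp add: poly_poch_poly algebra_simps)
    finally show ?thesis .
  qed
  moreover have "degree p \<le> Suc n"
    unfolding p_def using q(1) by (intro degree_add_le degree_monom_le) auto
  moreover have "coeff p (Suc n) = c"
    using q(1) by (simp add: p_def coeff_eq_0)
  moreover have "poly p 1 = coeff P (Suc n)"
  proof -
    have "coeff (poch_poly 1 (Suc n)) (Suc n) = 1"
      using monic_prod_linear[of "\<lambda>i. 1 + real i" "{..<Suc n}"] degree_poch_poly[of 1 "Suc n"]
      by (simp add: poch_poly_def)
    moreover have "coeff ([:- r, 1:] * R) (Suc n) = coeff R n"
      using deg_R by (simp add: coeff_eq_0)
    ultimately have "coeff P (Suc n) = coeff R n + c"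
      by (subst P) (simp only: coeff_add coeff_smult mult_1_right)
    then show ?thesis
      using q(3) by (simp add: p_def poly_monom)
  qed
  ultimately show ?case
    by (intro exI[of _ p]) (auto simp: c_def z_def r_def)
qed

section \<open>Explicit biorthogonal systems\<close>

text \<open>
  The factor of the product over the nodes in the transform of the monic orthogonal polynomial,
  which is also the value of that polynomial at 1.
\<close>

definition bpoly_value :: "nat \<Rightarrow> real" where
  "bpoly_value n = pochhammer (\<alpha>0 + 1) n / (\<Prod>i<n. real n + \<alpha>0 + 1 + s i)"

lemma node_factor_pos:
  assumes "n > 0"
  shows "real n + \<alpha>0 + 1 + s i > 0"
proof -
  have "real n \<ge> 1"
    using assms by simp
  then show ?thesis
    using node_gt[of i] \<alpha>0 by linarith
qed

lemma bpoly_value_pos: "bpoly_value n > 0"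
  unfolding bpoly_value_def using \<alpha>0 by (intro divide_pos_pos pochhammer_pos prod_pos node_factor_pos ballI) auto

text \<open>
  The zeros of the product express orthogonality, and the value of the product at \<open>- (n + \<alpha>0 + 1)\<close>
  shows that the polynomial is monic.
\<close>

lemma bpoly_exists:
  "\<exists>p. degree p = n \<and> lead_coeff p = 1 \<and> poly p 1 = bpoly_value n \<and>
    (\<forall>\<sigma>>-1. mellin p \<sigma> = mellin_factor n \<sigma> * (bpoly_value n * (\<Prod>i<n. \<sigma> - s i)))"
proof -
  define P where "P = smult (bpoly_value n) (\<Prod>i<n. [:- s i, 1:])"
  have "degree P \<le> n"
    using degree_smult_le[of "bpoly_value n" "\<Prod>i<n. [:- s i, 1:]"] degree_prod_linear[of "\<lambda>i. - s i" "{..<n}"]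
    by (simp add: P_def)
  from mellin_surj[OF this] obtain p where p: "degree p \<le> n" "\<And>\<sigma>. \<sigma> > -1 \<Longrightarrow> mellin p \<sigma> = mellin_factor n \<sigma> * poly P \<sigma>"
      "coeff p n = poly P (- (real n + \<alpha>0 + 1)) / ((-1) ^ n * pochhammer (\<alpha>0 + 1) n)"
      "poly p 1 = coeff P n"
    by blast
  have poly_P: "poly P x = bpoly_value n * (\<Prod>i<n. x - s i)" for x
    by (simp add: P_def poly_prod)
  have "(\<Prod>i<n. - (real n + \<alpha>0 + 1) - s i) = (\<Prod>i<n. (-1) * (real n + \<alpha>0 + 1 + s i))"
    by (intro prod.cong) auto
  also have "\<dots> = (-1) ^ n * (\<Prod>i<n. real n + \<alpha>0 + 1 + s i)"
    by (subst prod.distrib) simp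
  finally have prod_P: "(\<Prod>i<n. - (real n + \<alpha>0 + 1) - s i) = (-1) ^ n * (\<Prod>i<n. real n + \<alpha>0 + 1 + s i)" .
  have "(\<Prod>i<n. real n + \<alpha>0 + 1 + s i) \<noteq> 0" "pochhammer (\<alpha>0 + 1) n \<noteq> 0"
    using bpoly_value_pos[of n] by (auto simp only: bpoly_value_def div_by_0 div_0 less_irrefl)
  then have "coeff p n = 1"
    unfolding p(3) poly_P prod_P bpoly_value_def by simp
  moreover from this have "degree p = n"
    using p(1) by (metis le_antisym le_degree zero_neq_one)
  moreover have "coeff P n = bpoly_value n"
    using monic_prod_linear[of "\<lambda>i. - s i" "{..<n}"] degree_prod_linear[of "\<lambda>i. - s i" "{..<n}"]
    by (simp add: P_def)
  ultimately show ?thesis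
    using p(2,4) by (intro exI[of _ p]) (simp add: poly_P)
qed

definition bpoly :: "nat \<Rightarrow> real poly" where
  "bpoly n = (SOME p. degree p = n \<and> lead_coeff p = 1 \<and> poly p 1 = bpoly_value n \<and>
    (\<forall>\<sigma>>-1. mellin p \<sigma> = mellin_factor n \<sigma> * (bpoly_value n * (\<Prod>i<n. \<sigma> - s i))))"

lemma degree_bpoly: "degree (bpoly n) = n"
  and monic_bpoly: "lead_coeff (bpoly n) = 1"
  and bpoly_at_1: "poly (bpoly n) 1 = bpoly_value n"
  and mellin_bpoly: "\<sigma> > -1 \<Longrightarrow> mellin (bpoly n) \<sigma> = mellin_factor n \<sigma> * (bpoly_value n * (\<Prod>i<n. \<sigma> - s i))"
  using someI_ex[OF bpoly_exists[of n], folded bpoly_def] by blast+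

text \<open>
  The coefficients of the type I form. Annihilating all polynomials of degree less than \<open>n\<close> forces,
  up to the Gamma factors, the Lagrange weights for extrapolation from the nodes to
  \<open>- (n + \<alpha>0 + 1)\<close>. The product omits \<open>i = j\<close>, because for \<open>n = 0\<close> the omitted factor
  \<open>\<alpha>0 + 1 + s 0\<close> may be zero.
\<close>

definition qcoef :: "nat \<Rightarrow> nat \<Rightarrow> real" where
  "qcoef n j = (\<Prod>i\<in>{..n} - {j}. (real n + \<alpha>0 + 1 + s i) / (s j - s i)) *
    (Gamma (s j + \<alpha>0 + real n + 2) / Gamma (s j + 1)) / (pochhammer (\<alpha>0 + 1) n * Gamma (\<alpha>0 + 1))"

lemma qcoef_alt:
  assumes n: "n > 0" and j: "j \<le> n"
  shows "qcoef n j = (\<Prod>i\<le>n. real n + \<alpha>0 + 1 + s i) / (pochhammer (\<alpha>0 + 1) n * Gamma (\<alpha>0 + 1)) *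
    (Gamma (s j + \<alpha>0 + real n + 1) / Gamma (s j + 1)) / (\<Prod>i\<in>{..n} - {j}. s j - s i)"
proof -
  have pos: "s j + \<alpha>0 + real n + 1 > 0"
    using node_factor_pos[OF n, of j] by (simp add: add_ac)
  then have "Gamma (s j + \<alpha>0 + real n + 1 + 1) = (s j + \<alpha>0 + real n + 1) * Gamma (s j + \<alpha>0 + real n + 1)"
    by (intro Gamma_plus1) (auto elim!: nonpos_Ints_cases)
  then have "Gamma (s j + \<alpha>0 + real n + 2) = (real n + \<alpha>0 + 1 + s j) * Gamma (s j + \<alpha>0 + real n + 1)"
    by (simp add: add_ac)
  moreover have "(\<Prod>i\<le>n. real n + \<alpha>0 + 1 + s i) =
      (real n + \<alpha>0 + 1 + s j) * (\<Prod>i\<in>{..n} - {j}. real n + \<alpha>0 + 1 + s i)"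
    using j by (subst prod.remove[of _ j]) auto
  ultimately show ?thesis
    by (simp add: qcoef_def prod_dividef mult_ac)
qed

text \<open>
  The integral of \<open>p\<close> against the type I form of index \<open>n\<close>.
\<close>

definition pairing :: "nat \<Rightarrow> real poly \<Rightarrow> real" where
  "pairing n p = (\<Sum>j\<le>n. qcoef n j * mellin p (s j))"

lemma sum_qcoef:
  assumes n: "n > 0"
  shows "bpoly_value n * (\<Sum>j\<le>n. qcoef n j) = (real n + \<alpha>0 + 1 + s n) / Gamma (\<alpha>0 + 1) * gamma_divdiff \<alpha>0 n"
proof -
  define E where "E = (\<Prod>i<n. real n + \<alpha>0 + 1 + s i)"
  have "E > 0"
    unfolding E_def using \<alpha>0 by (intro prod_pos node_factor_pos ballI) auto
  moreover have "pochhammer (\<alpha>0 + 1) n > 0"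
    using \<alpha>0 by (intro pochhammer_pos) simp
  moreover have "(\<Prod>i\<le>n. real n + \<alpha>0 + 1 + s i) = E * (real n + \<alpha>0 + 1 + s n)"
    by (simp add: E_def lessThan_Suc_atMost[symmetric])
  moreover have "(\<Sum>j\<le>n. qcoef n j) = (\<Prod>i\<le>n. real n + \<alpha>0 + 1 + s i) / (pochhammer (\<alpha>0 + 1) n * Gamma (\<alpha>0 + 1)) * gamma_divdiff \<alpha>0 n"
    unfolding gamma_divdiff_def divdiff_def sum_distrib_left using n by (intro sum.cong) (auto simp: qcoef_alt)
  ultimately show ?thesis
    by (simp add: bpoly_value_def flip: E_def)
qed

text \<open>
  The Gamma quotients in the weights and in the transform cancel up to a Pochhammer polynomial of
  degree \<open>n - m - 1\<close>.
\<close>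

lemma pairing_eq_divdiff:
  assumes "m < n" "\<And>\<sigma>. \<sigma> > -1 \<Longrightarrow> mellin p \<sigma> = mellin_factor m \<sigma> * poly P \<sigma>"
  shows "pairing n p = (\<Prod>i\<le>n. real n + \<alpha>0 + 1 + s i) / pochhammer (\<alpha>0 + 1) n *
    divdiff s (poly (poch_poly (real m + \<alpha>0 + 2) (n - m - 1) * P)) {..n}"
  unfolding pairing_def divdiff_def sum_distrib_left
proof (rule sum.cong[OF refl])
  fix j assume "j \<in> {..n}"
  then have j: "j \<le> n" and n: "n > 0"
    using assms(1) by auto
  have pos: "Gamma (s j + 1) > 0" "Gamma (\<alpha>0 + 1) > 0" "Gamma (s j + real m + \<alpha>0 + 2) > 0"
    using node_gt[of j] \<alpha>0 by (auto intro!: Gamma_real_pos)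
  have "Gamma (s j + real m + \<alpha>0 + 2 + real (n - m - 1)) / Gamma (s j + real m + \<alpha>0 + 2) =
      pochhammer (s j + real m + \<alpha>0 + 2) (n - m - 1)"
    using node_gt[of j] \<alpha>0 by (intro Gamma_ratio_real) auto
  moreover have "s j + real m + \<alpha>0 + 2 + real (n - m - 1) = s j + \<alpha>0 + real n + 1"
    using assms(1) by (simp add: of_nat_diff)
  ultimately have G: "Gamma (s j + \<alpha>0 + real n + 1) =
      pochhammer (s j + real m + \<alpha>0 + 2) (n - m - 1) * Gamma (s j + real m + \<alpha>0 + 2)"
    using pos by (simp add: field_simps)
  have P_j: "poly (poch_poly (real m + \<alpha>0 + 2) (n - m - 1) * P) (s j) =
      pochhammer (s j + real m + \<alpha>0 + 2) (n - m - 1) * poly P (s j)"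
    by (simp add: poly_poch_poly add.assoc)
  then show "qcoef n j * mellin p (s j) = (\<Prod>i\<le>n. real n + \<alpha>0 + 1 + s i) / pochhammer (\<alpha>0 + 1) n *
      (poly (poch_poly (real m + \<alpha>0 + 2) (n - m - 1) * P) (s j) / (\<Prod>i\<in>{..n} - {j}. s j - s i))"
    unfolding qcoef_alt[OF n j] assms(2)[OF node_gt] mellin_factor_def G P_j using pos by simp
qed

text \<open>
  Below the diagonal the divided difference has order \<open>n\<close> and the polynomial degree at most \<open>n - 1\<close>;
  on the diagonal only the node \<open>s n\<close> contributes; above it the transform vanishes at all nodes.
\<close>

lemma pairing_bpoly: "pairing n (bpoly m) = (if m = n then 1 else 0)"
proof (rule linorder_cases[of m n])
  assume mn: "m < n"
  define P where "P = smult (bpoly_value m) (\<Prod>i<m. [:- s i, 1:])"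
  have "pairing n (bpoly m) = (\<Prod>i\<le>n. real n + \<alpha>0 + 1 + s i) / pochhammer (\<alpha>0 + 1) n *
      divdiff s (poly (poch_poly (real m + \<alpha>0 + 2) (n - m - 1) * P)) {..n}"
    using mn by (intro pairing_eq_divdiff) (auto simp: mellin_bpoly P_def poly_prod)
  also have "divdiff s (poly (poch_poly (real m + \<alpha>0 + 2) (n - m - 1) * P)) {..n} = 0"
  proof (rule divdiff_poly)
    have "degree P \<le> m"
      using degree_smult_le[of "bpoly_value m" "\<Prod>i<m. [:- s i, 1:]"] degree_prod_linear[of "\<lambda>i. - s i" "{..<m}"]
      by (simp add: P_def)
    then show "Suc (degree (poch_poly (real m + \<alpha>0 + 2) (n - m - 1) * P)) < card {..n}"
      using degree_mult_le[of "poch_poly (real m + \<alpha>0 + 2) (n - m - 1)" P] mn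
      by (simp add: degree_poch_poly)
  qed (auto simp: inj_on_node)
  finally show ?thesis
    using mn by simp
next
  assume [simp]: "m = n"
  define E where "E = (\<Prod>i<n. real n + \<alpha>0 + 1 + s i)"
  define F where "F = (\<Prod>i<n. s n - s i)"
  define P where "P = pochhammer (\<alpha>0 + 1) n"
  have "mellin (bpoly n) (s j) = 0" if "j < n" for j
    using that by (auto simp: mellin_bpoly node_gt)
  then have "pairing n (bpoly n) = qcoef n n * mellin (bpoly n) (s n)"
    by (simp add: pairing_def lessThan_Suc_atMost[symmetric])
  also have "\<dots> = 1"
  proof -
    have pos: "E > 0" "P > 0"
      using \<alpha>0 unfolding E_def P_def by (auto intro!: prod_pos node_factor_pos pochhammer_pos)
    have F: "F \<noteq> 0"
      unfolding F_def using inj_node by (auto dest: injD)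
    have set: "{..n} - {n} = {..<n}"
      by auto
    have Gpos: "Gamma (s n + 1) > 0" "Gamma (\<alpha>0 + 1) > 0" "Gamma (s n + real n + \<alpha>0 + 2) > 0"
      using node_gt[of n] \<alpha>0 by (auto intro!: Gamma_real_pos)
    have "qcoef n n = E / F * (Gamma (s n + real n + \<alpha>0 + 2) / Gamma (s n + 1)) / (P * Gamma (\<alpha>0 + 1))"
      by (simp add: qcoef_def set prod_dividef E_def F_def P_def add_ac)
    moreover have "mellin (bpoly n) (s n) =
        Gamma (s n + 1) * Gamma (\<alpha>0 + 1) / Gamma (s n + real n + \<alpha>0 + 2) * (P / E * F)"
      by (simp add: mellin_bpoly node_gt mellin_factor_def bpoly_value_def E_def F_def P_def)
    ultimately show ?thesis
      using pos F Gpos by simp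
  qed
  finally show ?thesis
    by simp
next
  assume "n < m"
  then have "mellin (bpoly m) (s j) = 0" if "j \<le> n" for j
    using that by (auto simp: mellin_bpoly node_gt)
  then show ?thesis
    using \<open>n < m\<close> by (simp add: pairing_def)
qed

lemma pairing_smult: "pairing n (smult c p) = c * pairing n p"
  by (simp add: pairing_def mellin_smult sum_distrib_left mult_ac)

lemma pairing_sum: "pairing n (\<Sum>i\<in>I. p i) = (\<Sum>i\<in>I. pairing n (p i))"
  by (simp add: pairing_def mellin_sum node_gt sum_distrib_left sum.swap[of _ I])

lemma pairing_bpoly_sum:
  assumes "finite I"
  shows "pairing n (\<Sum>i\<in>I. smult (c i) (bpoly i)) = (if n \<in> I then c n else 0)"
  using assms by (simp add: pairing_sum pairing_smult pairing_bpoly if_distrib cong: if_cong)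

text \<open>
  Biorthogonality reads off the coefficients in the basis of monic polynomials.
\<close>

lemma bpoly_expansion:
  assumes "\<And>i. i \<ge> n \<Longrightarrow> coeff p i = 0"
  shows "p = (\<Sum>i<n. smult (pairing i p) (bpoly i))"
proof -
  have "\<exists>c. p = (\<Sum>i<n. smult (c i) (bpoly i))"
    using assms
  proof (induction n arbitrary: p)
    case 0
    then show ?case
      by (simp add: poly_eq_iff)
  next
    case (Suc n)
    define q where "q = p - smult (coeff p n) (bpoly n)"
    have "coeff q i = 0" if "i \<ge> n" for i
    proof (cases "i = n")
      case True
      then show ?thesis
        using monic_bpoly[of n] by (simp add: q_def degree_bpoly)
    next
      case False
      then show ?thesis
        using that Suc.prems[of i] by (simp add: q_def coeff_eq_0 degree_bpoly)
    qed
    then obtain c where c: "q = (\<Sum>i<n. smult (c i) (bpoly i))"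
      using Suc.IH by blast
    have "(\<Sum>i<n. smult ((c(n := coeff p n)) i) (bpoly i)) = (\<Sum>i<n. smult (c i) (bpoly i))"
      by (intro sum.cong) auto
    then have "p = (\<Sum>i<Suc n. smult ((c(n := coeff p n)) i) (bpoly i))"
      using c by (simp add: q_def algebra_simps)
    then show ?case
      by blast
  qed
  then obtain c where c: "p = (\<Sum>i<n. smult (c i) (bpoly i))"
    by blast
  have "pairing i p = c i" if "i < n" for i
    using that by (subst c) (simp add: pairing_bpoly_sum)
  then show ?thesis
    by (subst c) simp
qed

lemma pairing_eq_0:
  assumes "\<And>i. i \<ge> n \<Longrightarrow> coeff p i = 0"
  shows "pairing n p = 0"
  using bpoly_expansion[OF assms] pairing_bpoly_sum[of "{..<n}" n "\<lambda>i. pairing i p"] by auto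

section \<open>Identification of the multiple orthogonal polynomials and linear forms\<close>

lemma jp_xi_eq: "x \<in> {0..1} \<Longrightarrow> jp_xi \<alpha>1 \<alpha>2 j x = x powr s j"
  by (cases "x = 0") (auto simp: jp_xi_def node_def powr_add powr_realpow)

lemma integral_poly_xi: "(LINT x|\<mu>. poly p x * jp_xi \<alpha>1 \<alpha>2 j x) = mellin p (s j)"
  unfolding mellin_def by (intro Bochner_Integration.integral_cong refl) (simp add: jp_xi_eq space_jp_measure)

lemma integrable_poly_xi: "integrable \<mu> (\<lambda>x. poly p x * jp_xi \<alpha>1 \<alpha>2 j x)"
proof -
  have "integrable \<mu> (\<lambda>x. poly p x * x powr s j)"
    by (intro mellin_integrable node_gt)
  then show ?thesis
    by (subst Bochner_Integration.integrable_cong[OF refl]) (auto simp: jp_xi_eq space_jp_measure)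
qed

lemma integral_poly_form:
  "(LINT x|\<mu>. poly p x * (\<Sum>i\<le>n. c i * jp_xi \<alpha>1 \<alpha>2 i x)) = (\<Sum>i\<le>n. c i * mellin p (s i))"
proof -
  have "(LINT x|\<mu>. poly p x * (\<Sum>i\<le>n. c i * jp_xi \<alpha>1 \<alpha>2 i x)) =
      (LINT x|\<mu>. (\<Sum>i\<le>n. c i * (poly p x * jp_xi \<alpha>1 \<alpha>2 i x)))"
    by (simp add: sum_distrib_left mult_ac)
  also have "\<dots> = (\<Sum>i\<le>n. LINT x|\<mu>. c i * (poly p x * jp_xi \<alpha>1 \<alpha>2 i x))"
    by (intro Bochner_Integration.integral_sum integrable_mult_right integrable_poly_xi)
  also have "\<dots> = (\<Sum>i\<le>n. c i * mellin p (s i))"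
    by (simp add: integral_poly_xi)
  finally show ?thesis .
qed

lemma mellin_bpoly_eq_0: "j < n \<Longrightarrow> mellin (bpoly n) (s j) = 0"
  by (auto simp: mellin_bpoly node_gt)

text \<open>
  The nodes are pairwise distinct because \<open>\<alpha>1 - \<alpha>2\<close> is not an integer.
\<close>

lemma mellin_bpoly_diag: "mellin (bpoly n) (s n) \<noteq> 0"
proof -
  have "s n - s i \<noteq> 0" if "i < n" for i
    using that inj_node by (auto dest: injD)
  then show ?thesis
    using mellin_factor_pos[OF node_gt, of n n] bpoly_value_pos[of n] by (auto simp: mellin_bpoly node_gt)
qed

lemma jp_B_eq: "jp_B \<alpha>0 \<alpha>1 \<alpha>2 n = bpoly n"
  unfolding jp_B_def integral_poly_xi
proof (rule the_equality)
  show "degree (bpoly n) = n \<and> lead_coeff (bpoly n) = 1 \<and> (\<forall>j<n. mellin (bpoly n) (s j) = 0)"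
    using degree_bpoly monic_bpoly mellin_bpoly_eq_0 by blast
next
  fix p assume p: "degree p = n \<and> lead_coeff p = 1 \<and> (\<forall>j<n. mellin p (s j) = 0)"
  define d where "d = p - bpoly n"
  have "coeff d i = 0" if "i \<ge> n" for i
    using that p monic_bpoly[of n] degree_bpoly[of n]
    by (cases "i = n") (auto simp: d_def coeff_eq_0)
  then have "d = (\<Sum>i<n. smult (pairing i d) (bpoly i))"
    by (rule bpoly_expansion)
  also have "\<dots> = 0"
  proof (rule sum.neutral, rule ballI)
    fix i assume i: "i \<in> {..<n}"
    have "mellin d (s j) = 0" if "j \<le> i" for j
      using that i p mellin_bpoly_eq_0[of j n] by (simp add: d_def mellin_diff node_gt)
    then show "smult (pairing i d) (bpoly i) = 0"
      by (simp add: pairing_def)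
  qed
  finally show "p = bpoly n"
    by (simp add: d_def)
qed

text \<open>
  The matrix of the transforms at the nodes is triangular with nonzero diagonal, so the coefficients
  vanish one after the other starting from the highest index.
\<close>

lemma form_coeff_unique:
  assumes "\<And>m. (\<Sum>i\<le>n. e i * mellin (bpoly m) (s i)) = 0" and "k \<le> n"
  shows "e (n - k) = 0"
  using \<open>k \<le> n\<close>
proof (induction k rule: less_induct)
  case (less k)
  define m where "m = n - k"
  have "e i * mellin (bpoly m) (s i) = 0" if "i \<le> n" "i \<noteq> m" for i
  proof (cases "i < m")
    case True
    then show ?thesis
      by (simp add: mellin_bpoly_eq_0)
  next
    case False
    then have "n - i < k" "n - i \<le> n" "n - (n - i) = i"
      using that less.prems by (auto simp: m_def)
    then show ?thesis
      using less.IH[of "n - i"] by simp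
  qed
  then have "(\<Sum>i\<in>{..n} - {m}. e i * mellin (bpoly m) (s i)) = 0"
    by (intro sum.neutral ballI) blast
  then have "(\<Sum>i\<le>n. e i * mellin (bpoly m) (s i)) = e m * mellin (bpoly m) (s m)"
    by (subst sum.remove[of _ m]) (auto simp: m_def)
  then show ?case
    using assms(1)[of m] mellin_bpoly_diag[of m] by (simp add: m_def)
qed

lemma jp_Q_eq: "jp_Q \<alpha>0 \<alpha>1 \<alpha>2 n = (\<lambda>x. \<Sum>i\<le>n. qcoef n i * jp_xi \<alpha>1 \<alpha>2 i x)"
  unfolding jp_Q_def jp_B_eq
proof (rule the_equality)
  let ?q = "\<lambda>x. \<Sum>i\<le>n. qcoef n i * jp_xi \<alpha>1 \<alpha>2 i x"
  have "(LINT x|\<mu>. x ^ j * ?q x) = 0" if "j < n" for j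
  proof -
    have "(LINT x|\<mu>. x ^ j * ?q x) = (LINT x|\<mu>. poly (monom 1 j) x * ?q x)"
      by (simp add: poly_monom)
    also have "\<dots> = pairing n (monom 1 j)"
      by (simp only: integral_poly_form pairing_def)
    also have "\<dots> = 0"
      using that by (intro pairing_eq_0) auto
    finally show ?thesis .
  qed
  moreover have "(LINT x|\<mu>. poly (bpoly m) x * ?q x) = (if m = n then 1 else 0)" for m
    using pairing_bpoly[of n m] by (simp only: integral_poly_form pairing_def)
  ultimately show "(\<exists>c. ?q = (\<lambda>x. \<Sum>i\<le>n. c i * jp_xi \<alpha>1 \<alpha>2 i x)) \<and>
     (\<forall>j<n. (LINT x|\<mu>. x ^ j * ?q x) = 0) \<and>
     (\<forall>m. (LINT x|\<mu>. poly (bpoly m) x * ?q x) = (if m = n then 1 else 0))"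
    by blast
next
  fix q
  assume q: "(\<exists>c. q = (\<lambda>x. \<Sum>i\<le>n. c i * jp_xi \<alpha>1 \<alpha>2 i x)) \<and>
     (\<forall>j<n. (LINT x|\<mu>. x ^ j * q x) = 0) \<and>
     (\<forall>m. (LINT x|\<mu>. poly (bpoly m) x * q x) = (if m = n then 1 else 0))"
  then obtain c where c: "q = (\<lambda>x. \<Sum>i\<le>n. c i * jp_xi \<alpha>1 \<alpha>2 i x)"
    by blast
  have "(\<Sum>i\<le>n. c i * mellin (bpoly m) (s i)) = (if m = n then 1 else 0)" for m
    using q unfolding c integral_poly_form by blast
  then have "(\<Sum>i\<le>n. (c i - qcoef n i) * mellin (bpoly m) (s i)) = 0" for m
    using pairing_bpoly[of n m] by (simp add: pairing_def left_diff_distrib sum_subtractf)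
  from form_coeff_unique[OF this] have "c i - qcoef n i = 0" if "i \<le> n" for i
    using that by (metis diff_diff_cancel diff_le_self)
  then show "q = (\<lambda>x. \<Sum>i\<le>n. qcoef n i * jp_xi \<alpha>1 \<alpha>2 i x)"
    unfolding c by simp
qed

section \<open>The Hessenberg matrix and its stochastic conjugates\<close>

text \<open>
  The entries of the Hessenberg matrix, extracted by biorthogonality.
\<close>

definition hess :: "nat \<Rightarrow> nat \<Rightarrow> real" where
  "hess n m = pairing m ([:0, 1:] * bpoly n)"

lemma coeff_x_bpoly: "i \<ge> Suc (Suc n) \<Longrightarrow> coeff ([:0, 1:] * bpoly n) i = 0"
  by (cases i) (auto simp: coeff_pCons coeff_eq_0 degree_bpoly)

lemma hess_above: "m \<ge> Suc (Suc n) \<Longrightarrow> hess n m = 0"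
  unfolding hess_def by (intro pairing_eq_0 coeff_x_bpoly) simp

text \<open>
  Multiplication by \<open>x\<close> shifts the argument of the transform by 1, that is, each node to the next but
  one.
\<close>

lemma hess_below:
  assumes "m + 2 < n"
  shows "hess n m = 0"
proof -
  have "mellin ([:0, 1:] * bpoly n) (s j) = 0" if "j \<le> m" for j
  proof -
    have "mellin ([:0, 1:] * bpoly n) (s j) = mellin (bpoly n) (s (Suc (Suc j)))"
      by (simp only: mellin_times_x node_add2)
    also have "\<dots> = 0"
      using assms that by (intro mellin_bpoly_eq_0) simp
    finally show ?thesis .
  qed
  then show ?thesis
    by (simp only: hess_def pairing_def) simp
qed

lemma x_bpoly: "[:0, 1:] * bpoly n = (\<Sum>m<Suc (Suc n). smult (hess n m) (bpoly m))"
  unfolding hess_def by (intro bpoly_expansion coeff_x_bpoly)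

text \<open>
  For uniqueness, pairing an expansion with the forms recovers its coefficients.
\<close>

lemma jp_H_eq: "jp_H \<alpha>0 \<alpha>1 \<alpha>2 n = hess n"
  unfolding jp_H_def jp_B_eq
proof (rule the_equality)
  have sub: "{m. hess n m \<noteq> 0} \<subseteq> {..<Suc (Suc n)}"
    using hess_above[of n] by (force simp: not_less[symmetric])
  then have "finite {m. hess n m \<noteq> 0}"
    by (rule finite_subset) simp
  moreover have "(\<Sum>m<Suc (Suc n). smult (hess n m) (bpoly m)) = (\<Sum>m | hess n m \<noteq> 0. smult (hess n m) (bpoly m))"
    using sub by (intro sum.mono_neutral_right) auto
  ultimately show "finite {m. hess n m \<noteq> 0} \<and>
      [:0, 1:] * bpoly n = (\<Sum>m | hess n m \<noteq> 0. smult (hess n m) (bpoly m))"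
    using x_bpoly by simp
next
  fix h :: "nat \<Rightarrow> real"
  assume h: "finite {m. h m \<noteq> 0} \<and> [:0, 1:] * bpoly n = (\<Sum>m | h m \<noteq> 0. smult (h m) (bpoly m))"
  show "h = hess n"
  proof
    fix m
    have "hess n m = pairing m (\<Sum>m | h m \<noteq> 0. smult (h m) (bpoly m))"
      using h by (simp only: hess_def)
    also have "\<dots> = h m"
      using h by (subst pairing_bpoly_sum) auto
    finally show "h m = hess n m"
      by simp
  qed
qed

definition hess_II :: "nat \<Rightarrow> nat \<Rightarrow> real" where
  "hess_II n m = inverse (bpoly_value n) * hess n m * bpoly_value m"

lemma jp_H_typeII_eq: "jp_H_typeII \<alpha>0 \<alpha>1 \<alpha>2 = hess_II"
  by (simp add: fun_eq_iff jp_H_typeII_def diag_conj_def jp_B_eq jp_H_eq bpoly_at_1 hess_II_def)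

text \<open>
  The product of the values at 1 of the type II polynomial and the type I form. Its ratios are the
  only difference between the two stochastic matrices.
\<close>

definition endpoint :: "nat \<Rightarrow> real" where
  "endpoint n = bpoly_value n * jp_Q \<alpha>0 \<alpha>1 \<alpha>2 n 1"

lemma jp_H_typeI_eq: "jp_H_typeI \<alpha>0 \<alpha>1 \<alpha>2 n m = hess_II m n * (endpoint m / endpoint n)"
  using bpoly_value_pos[of n] bpoly_value_pos[of m]
  by (simp add: jp_H_typeI_def diag_conj_def jp_H_eq hess_II_def endpoint_def field_simps)

lemma endpoint_eq:
  assumes "n > 0"
  shows "endpoint n = (real n + \<alpha>0 + 1 + s n) / Gamma (\<alpha>0 + 1) * gamma_divdiff \<alpha>0 n"
  using sum_qcoef[OF assms] by (simp add: endpoint_def jp_Q_eq jp_xi_def)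

lemma endpoint_pos: "endpoint (Suc n) > 0"
proof -
  have "gamma_divdiff \<alpha>0 (Suc n) > 0"
    using gamma_divdiff_pos_and_ratio[OF \<alpha>0] by blast
  moreover have "real (Suc n) + \<alpha>0 + 1 + s (Suc n) > 0"
    by (intro node_factor_pos) auto
  moreover have "Gamma (\<alpha>0 + 1) > 0"
    using \<alpha>0 by (intro Gamma_real_pos) simp
  ultimately show ?thesis
    by (simp add: endpoint_eq del: of_nat_Suc)
qed

lemma node_lin_lim: "(\<lambda>n. (real n * c + d + s (n + i)) / real n) \<longlonglongrightarrow> c + 1 / 2"
proof -
  have "(\<lambda>n. (real n * c + d) / real n + s (n + i) / real (n + i) * (real (n + i) / real n)) \<longlonglongrightarrow> c + 1 / 2 * 1"
  proof (rule tendsto_add[OF _ tendsto_mult[OF LIMSEQ_ignore_initial_segment[OF node_over_n]]])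
    show "(\<lambda>n. (real n * c + d) / real n) \<longlonglongrightarrow> c" "(\<lambda>n. real (n + i) / real n) \<longlonglongrightarrow> 1"
      by real_asymp+
  qed
  moreover have "\<forall>\<^sub>F n in sequentially. (real n * c + d) / real n + s (n + i) / real (n + i) * (real (n + i) / real n) =
      (real n * c + d + s (n + i)) / real n"
    using eventually_gt_at_top[of 0] by eventually_elim (simp add: add_divide_distrib del: of_nat_add)
  ultimately have "(\<lambda>n. (real n * c + d + s (n + i)) / real n) \<longlonglongrightarrow> c + 1 / 2 * 1"
    by (rule Lim_transform_eventually)
  then show ?thesis
    by simp
qed

lemma endpoint_ratio: "(\<lambda>n. endpoint (Suc n) / endpoint n) \<longlonglongrightarrow> 1"
proof -
  define A where "A n = real n + \<alpha>0 + 1 + s n" for n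
  have lim: "(\<lambda>n. A n / real n) \<longlonglongrightarrow> 3 / 2"
    using node_lin_lim[of 1 "\<alpha>0 + 1" 0] by (simp add: A_def add_ac)
  have "(\<lambda>n. (A (Suc n) / real (Suc n)) / (A n / real n) * (real (Suc n) / real n) * (gamma_divdiff \<alpha>0 (Suc n) / gamma_divdiff \<alpha>0 n)) \<longlonglongrightarrow>
      (3/2) / (3/2) * 1 * 1"
  proof (rule tendsto_mult[OF tendsto_mult[OF tendsto_divide[OF LIMSEQ_Suc[OF lim] lim]]])
    show "(\<lambda>n. real (Suc n) / real n) \<longlonglongrightarrow> 1"
      by real_asymp
    show "(\<lambda>n. gamma_divdiff \<alpha>0 (Suc n) / gamma_divdiff \<alpha>0 n) \<longlonglongrightarrow> 1"
      using gamma_divdiff_pos_and_ratio[OF \<alpha>0] by blast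
  qed simp
  moreover have "\<forall>\<^sub>F n in sequentially. (A (Suc n) / real (Suc n)) / (A n / real n) * (real (Suc n) / real n) * (gamma_divdiff \<alpha>0 (Suc n) / gamma_divdiff \<alpha>0 n) =
      endpoint (Suc n) / endpoint n"
    using eventually_gt_at_top[of 0]
  proof eventually_elim
    case (elim n)
    have "Gamma (\<alpha>0 + 1) > 0"
      using \<alpha>0 by (intro Gamma_real_pos) simp
    then show ?case
      using elim by (simp add: endpoint_eq A_def del: of_nat_Suc)
  qed
  ultimately have "(\<lambda>n. endpoint (Suc n) / endpoint n) \<longlonglongrightarrow> (3/2) / (3/2) * 1 * 1"
    by (rule Lim_transform_eventually)
  then show ?thesis
    by simp
qed

text \<open>
  For negative \<open>k\<close> the truncation by \<open>nat\<close> affects only finitely many \<open>n\<close>.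
\<close>

lemma endpoint_ratio_int: "(\<lambda>n. endpoint (nat (int n + k)) / endpoint n) \<longlonglongrightarrow> 1"
proof -
  have lim: "(\<lambda>n. endpoint (n + m) / endpoint n) \<longlonglongrightarrow> 1" for m
  proof -
    have "(\<lambda>n. endpoint (Suc (n + m)) / endpoint (Suc n)) \<longlonglongrightarrow> 1"
      using endpoint_pos LIMSEQ_Suc[OF endpoint_ratio] by (rule ratio_shift[of "\<lambda>n. endpoint (Suc n)"])
    then show ?thesis
      by (intro LIMSEQ_imp_Suc[of "\<lambda>n. endpoint (n + m) / endpoint n"]) simp
  qed
  show ?thesis
  proof (cases "k \<ge> 0")
    case True
    then have "nat (int n + k) = n + nat k" for n
      by simp
    then show ?thesis
      using lim by simp
  next
    case False
    define m where "m = nat (- k)"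
    have "(\<lambda>n. inverse (endpoint (n + m) / endpoint n)) \<longlonglongrightarrow> inverse 1"
      by (intro tendsto_inverse lim) simp
    then have "(\<lambda>n. endpoint n / endpoint (n + m)) \<longlonglongrightarrow> 1"
      by simp
    moreover have "nat (int (n + m) + k) = n" for n
      using False by (simp add: m_def)
    ultimately have "(\<lambda>n. endpoint (nat (int (n + m) + k)) / endpoint (n + m)) \<longlonglongrightarrow> 1"
      by simp
    then show ?thesis
      by (rule LIMSEQ_offset)
  qed
qed

text \<open>
  Expand \<open>x * bpoly (N + 2)\<close> and take Mellin transforms at \<open>t\<close>. Since the nodes \<open>s 2, s 3, \<dots>\<close> are the
  nodes \<open>s 0, s 1, \<dots>\<close> shifted by 1, the factors \<open>t - s i\<close> with \<open>i < N\<close> occur in every term; cancelling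
  them together with the Gamma factors leaves cubics. For large \<open>t\<close> none of the cancelled factors
  is zero.
\<close>

section \<open>Limits of the type II entries\<close>

lemma hess_II_identity_large:
  fixes t :: real and N :: nat
  assumes t: "t > real N + (\<bar>\<alpha>1\<bar> + \<bar>\<alpha>2\<bar>)"
  defines "u \<equiv> real N + \<alpha>0" and "h \<equiv> hess_II (N + 2)"
  shows "(t + 1) * (t + 1 - \<alpha>1) * (t + 1 - \<alpha>2) =
    h (N + 3) * ((t - s N) * (t - s (N + 1)) * (t - s (N + 2))) +
    h (N + 2) * ((t + u + 4) * (t - s N) * (t - s (N + 1))) +
    h (N + 1) * ((t + u + 4) * (t + u + 3) * (t - s N)) +
    h N * ((t + u + 4) * (t + u + 3) * (t + u + 2))"
proof -
  have t_gt: "t > -1" "t + 1 > -1"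
    using t by linarith+
  define H where "H m = hess (N + 2) m" for m
  define P where "P = (\<Prod>i<N. t - s i)"
  define w where "w = mellin_factor (N + 3) t"
  have "t - s i > 0" if "i < N" for i
    using node_upper[of i] that t by (simp add: field_simps)
  then have P: "P > 0"
    unfolding P_def by (intro prod_pos) auto
  have w: "w > 0"
    unfolding w_def using t_gt by (intro mellin_factor_pos)
  have Cpos: "bpoly_value (N + 2) > 0"
    by (rule bpoly_value_pos)
  have W2: "mellin_factor (N + 2) t = w * (t + u + 4)"
    using mellin_factor_Suc[OF t_gt(1), of "N + 2"] by (simp add: w_def u_def add_ac numeral_eq_Suc)
  have W1: "mellin_factor (N + 1) t = w * (t + u + 4) * (t + u + 3)"
    using mellin_factor_Suc[OF t_gt(1), of "N + 1"] W2 by (simp add: u_def add_ac numeral_eq_Suc)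
  have W0: "mellin_factor N t = w * (t + u + 4) * (t + u + 3) * (t + u + 2)"
    using mellin_factor_Suc[OF t_gt(1), of "N"] W1 by (simp add: u_def add_ac)
  have Wl: "mellin_factor (N + 2) (t + 1) = w * (t + 1)"
  proof -
    have "Gamma (t + 1 + 1) = (t + 1) * Gamma (t + 1)"
      using t_gt by (intro Gamma_plus1) (auto elim!: nonpos_Ints_cases)
    moreover have "t + 1 + real (N + 2) + \<alpha>0 + 2 = t + real (N + 3) + \<alpha>0 + 2"
      by simp
    ultimately show ?thesis
      unfolding w_def mellin_factor_def by simp
  qed
  have prod_l: "(\<Prod>i<N + 2. t + 1 - s i) = (t + 1 - \<alpha>1) * (t + 1 - \<alpha>2) * P"
  proof -
    have "(\<Prod>i<Suc (Suc N). t + 1 - s i) = (t + 1 - s 0) * ((t + 1 - s 1) * (\<Prod>i<N. t + 1 - s (Suc (Suc i))))"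
      by (simp only: prod.lessThan_Suc_shift) simp
    then show ?thesis
      by (simp add: node_add2 P_def) (simp add: node_def)
  qed
  define L A0 A1 A2 A3 where "L = (t + 1) * (t + 1 - \<alpha>1) * (t + 1 - \<alpha>2)"
    and "A0 = (t + u + 4) * (t + u + 3) * (t + u + 2)" and "A1 = (t + u + 4) * (t + u + 3) * (t - s N)"
    and "A2 = (t + u + 4) * (t - s N) * (t - s (N + 1))" and "A3 = (t - s N) * (t - s (N + 1)) * (t - s (N + 2))"
  have "mellin ([:0, 1:] * bpoly (N + 2)) t = (\<Sum>m<Suc (Suc (N + 2)). H m * mellin (bpoly m) t)"
    unfolding H_def by (subst x_bpoly) (simp only: mellin_sum[OF t_gt(1)] mellin_smult)
  also have "\<dots> = (\<Sum>m\<in>{N, N + 1, N + 2, N + 3}. H m * mellin (bpoly m) t)"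
    by (rule sum.mono_neutral_right) (auto simp: H_def hess_below)
  also have "\<dots> = H N * mellin (bpoly N) t + H (N + 1) * mellin (bpoly (N + 1)) t +
      H (N + 2) * mellin (bpoly (N + 2)) t + H (N + 3) * mellin (bpoly (N + 3)) t"
    by simp
  finally have "mellin (bpoly (N + 2)) (t + 1) = H N * mellin (bpoly N) t + H (N + 1) * mellin (bpoly (N + 1)) t +
      H (N + 2) * mellin (bpoly (N + 2)) t + H (N + 3) * mellin (bpoly (N + 3)) t"
    by (simp only: mellin_times_x)
  moreover have "mellin (bpoly (N + 2)) (t + 1) = w * P * (bpoly_value (N + 2) * L)"
    by (simp only: mellin_bpoly[OF t_gt(2)] Wl prod_l L_def mult_ac)
  moreover have "mellin (bpoly N) t = w * P * (bpoly_value N * A0)"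
    by (simp only: mellin_bpoly[OF t_gt(1)] W0 P_def[symmetric] A0_def mult_ac)
  moreover have "mellin (bpoly (N + 1)) t = w * P * (bpoly_value (N + 1) * A1)"
    by (simp only: mellin_bpoly[OF t_gt(1)] W1) (simp add: P_def A1_def)
  moreover have "mellin (bpoly (N + 2)) t = w * P * (bpoly_value (N + 2) * A2)"
    by (simp only: mellin_bpoly[OF t_gt(1)] W2) (simp add: P_def A2_def numeral_eq_Suc)
  moreover have "mellin (bpoly (N + 3)) t = w * P * (bpoly_value (N + 3) * A3)"
    by (simp only: mellin_bpoly[OF t_gt(1)] w_def) (simp add: P_def A3_def numeral_eq_Suc)
  ultimately have "(w * P) * (bpoly_value (N + 2) * L) = (w * P) *
      (H (N + 3) * bpoly_value (N + 3) * A3 + H (N + 2) * bpoly_value (N + 2) * A2 + H (N + 1) * bpoly_value (N + 1) * A1 + H N * bpoly_value N * A0)"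
    by (simp only: distrib_left mult_ac add_ac)
  moreover have "w * P \<noteq> 0"
    using w P by simp
  ultimately have "bpoly_value (N + 2) * L =
      H (N + 3) * bpoly_value (N + 3) * A3 + H (N + 2) * bpoly_value (N + 2) * A2 + H (N + 1) * bpoly_value (N + 1) * A1 + H N * bpoly_value N * A0"
    by (metis mult_left_cancel)
  moreover have "H m * bpoly_value m = bpoly_value (N + 2) * h m" for m
    using Cpos by (simp add: h_def hess_II_def H_def)
  ultimately have "bpoly_value (N + 2) * L = bpoly_value (N + 2) * (h (N + 3) * A3 + h (N + 2) * A2 + h (N + 1) * A1 + h N * A0)"
    by (simp only: distrib_left mult.assoc)
  then have "L = h (N + 3) * A3 + h (N + 2) * A2 + h (N + 1) * A1 + h N * A0"
    using Cpos by (metis less_irrefl mult_left_cancel)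
  then show ?thesis
    by (simp only: L_def A0_def A1_def A2_def A3_def)
qed

lemma hess_II_identity:
  fixes N :: nat
  defines "u \<equiv> real N + \<alpha>0" and "h \<equiv> hess_II (N + 2)"
  shows "cubic 1 (1 - \<alpha>1) (1 - \<alpha>2) =
    smult (h (N + 3)) (cubic (- s N) (- s (N + 1)) (- s (N + 2))) +
    smult (h (N + 2)) (cubic (u + 4) (- s N) (- s (N + 1))) +
    smult (h (N + 1)) (cubic (u + 4) (u + 3) (- s N)) +
    smult (h N) (cubic (u + 4) (u + 3) (u + 2))"
proof (rule poly_eq_if_eventually_eq)
  fix x assume "x > real N + (\<bar>\<alpha>1\<bar> + \<bar>\<alpha>2\<bar>)"
  from hess_II_identity_large[OF this]
  show "poly (cubic 1 (1 - \<alpha>1) (1 - \<alpha>2)) x =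
    poly (smult (h (N + 3)) (cubic (- s N) (- s (N + 1)) (- s (N + 2))) +
      smult (h (N + 2)) (cubic (u + 4) (- s N) (- s (N + 1))) +
      smult (h (N + 1)) (cubic (u + 4) (u + 3) (- s N)) +
      smult (h N) (cubic (u + 4) (u + 3) (u + 2))) x"
    by (simp only: poly_cubic u_def h_def poly_add poly_smult add.assoc diff_conv_add_uminus)
qed

text \<open>
  At the node \<open>s N\<close> the other three cubics vanish.
\<close>

lemma hess_II_lowest:
  fixes N defines "u \<equiv> real N + \<alpha>0"
  shows "hess_II (N + 2) N * ((s N + (u + 4)) * (s N + (u + 3)) * (s N + (u + 2))) =
    (s N + 1) * (s N + (1 - \<alpha>1)) * (s N + (1 - \<alpha>2))"
  using arg_cong[OF hess_II_identity[of N, folded u_def], of "\<lambda>p. poly p (s N)"]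
  by (simp only: poly_add poly_smult poly_cubic right_minus mult_zero_left mult_zero_right add_0_left)

text \<open>
  At \<open>t = - (N + \<alpha>0 + 4)\<close> the other three cubics vanish.
\<close>

lemma hess_II_highest:
  fixes N defines "u \<equiv> real N + \<alpha>0"
  shows "hess_II (N + 2) (N + 3) * ((u + 4 + s N) * (u + 4 + s (N + 1)) * (u + 4 + s (N + 2))) =
    (u + 3) * (u + 3 + \<alpha>1) * (u + 3 + \<alpha>2)"
proof -
  have "poly (cubic 1 (1 - \<alpha>1) (1 - \<alpha>2)) (- (u + 4)) =
      hess_II (N + 2) (N + 3) * poly (cubic (- s N) (- s (N + 1)) (- s (N + 2))) (- (u + 4))"
    using arg_cong[OF hess_II_identity[of N, folded u_def], of "\<lambda>p. poly p (- (u + 4))"]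
    by (simp only: poly_add poly_smult poly_cubic left_minus mult_zero_left mult_zero_right add_0_right)
  moreover have "poly (cubic 1 (1 - \<alpha>1) (1 - \<alpha>2)) (- (u + 4)) = - ((u + 3) * (u + 3 + \<alpha>1) * (u + 3 + \<alpha>2))"
  proof -
    have "- (u + 4) + 1 = - (u + 3)" "- (u + 4) + (1 - \<alpha>1) = - (u + 3 + \<alpha>1)"
        "- (u + 4) + (1 - \<alpha>2) = - (u + 3 + \<alpha>2)"
      by simp_all
    then show ?thesis
      by (simp only: poly_cubic mult_minus_left mult_minus_right minus_minus)
  qed
  moreover have "poly (cubic (- s N) (- s (N + 1)) (- s (N + 2))) (- (u + 4)) =
      - ((u + 4 + s N) * (u + 4 + s (N + 1)) * (u + 4 + s (N + 2)))"
    by (simp only: poly_cubic minus_add_distrib[symmetric] mult_minus_left mult_minus_right minus_minus)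
  ultimately show ?thesis
    by simp
qed

text \<open>
  The coefficients of \<open>t ^ 3\<close> and \<open>t ^ 2\<close> in the identity of cubics. The first relation says that the
  rows of the type II matrix add up to 1.
\<close>

lemma hess_II_linear_relations:
  fixes N defines "u \<equiv> real N + \<alpha>0" and "h \<equiv> hess_II (N + 2)"
  shows "h (N + 3) + h (N + 2) + h (N + 1) + h N = 1"
    and "3 - \<alpha>1 - \<alpha>2 = - h (N + 3) * (s N + s (N + 1) + s (N + 2)) +
      h (N + 2) * (u + 4 - s N - s (N + 1)) + h (N + 1) * (2 * u + 7 - s N) + h N * (3 * u + 9)"
proof -
  note id = hess_II_identity[of N, folded u_def h_def]
  show "h (N + 3) + h (N + 2) + h (N + 1) + h N = 1"
    using arg_cong[OF id, of "\<lambda>p. coeff p 3"] by (simp only: coeff_add coeff_smult coeff_cubic mult_1_right)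
  show "3 - \<alpha>1 - \<alpha>2 = - h (N + 3) * (s N + s (N + 1) + s (N + 2)) +
      h (N + 2) * (u + 4 - s N - s (N + 1)) + h (N + 1) * (2 * u + 7 - s N) + h N * (3 * u + 9)"
    using arg_cong[OF id, of "\<lambda>p. coeff p 2"]
    by (simp only: coeff_add coeff_smult coeff_cubic) (simp add: algebra_simps)
qed

lemma hess_II_lim_outer:
  "(\<lambda>N. hess_II (N + 2) N) \<longlonglongrightarrow> 1 / 27" "(\<lambda>N. hess_II (N + 2) (N + 3)) \<longlonglongrightarrow> 8 / 27"
proof -
  have node_lim: "(\<lambda>N. (real N + \<alpha>0 + c + s (N + i)) / real N) \<longlonglongrightarrow> 3 / 2" for c i
    using node_lin_lim[of 1 "\<alpha>0 + c" i] by (simp add: add.assoc)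
  have pos: "real N + \<alpha>0 + c + s i > 0" if "c \<ge> 2" for N c i
    using node_gt[of i] \<alpha>0 that by linarith
  have "(\<lambda>N. hess_II (N + 2) N) \<longlonglongrightarrow> ((1/2) * (1/2) * (1/2)) / ((3/2) * (3/2) * (3/2))"
  proof (rule product_quotient_limit[OF hess_II_lowest])
    show "(\<lambda>N. (s N + (real N + \<alpha>0 + 4)) / real N) \<longlonglongrightarrow> 3 / 2"
      "(\<lambda>N. (s N + (real N + \<alpha>0 + 3)) / real N) \<longlonglongrightarrow> 3 / 2"
      "(\<lambda>N. (s N + (real N + \<alpha>0 + 2)) / real N) \<longlonglongrightarrow> 3 / 2"
      using node_lim[where i = 0] by (simp_all only: add.commute[of "s _"] add_0_right)
    show "(\<lambda>N. (s N + 1) / real N) \<longlonglongrightarrow> 1 / 2" "(\<lambda>N. (s N + (1 - \<alpha>1)) / real N) \<longlonglongrightarrow> 1 / 2"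
      "(\<lambda>N. (s N + (1 - \<alpha>2)) / real N) \<longlonglongrightarrow> 1 / 2"
      using node_lin_lim[of 0 _ 0] by (simp_all only: add.commute[of "s _"] add_0_right mult_zero_right add_0_left)
    show "(s N + (real N + \<alpha>0 + 4)) * (s N + (real N + \<alpha>0 + 3)) * (s N + (real N + \<alpha>0 + 2)) \<noteq> 0" for N
      using pos[of 4 N N] pos[of 3 N N] pos[of 2 N N] by (simp add: add.commute[of "s _"])
  qed simp
  then show "(\<lambda>N. hess_II (N + 2) N) \<longlonglongrightarrow> 1 / 27"
    by simp
  have "(\<lambda>N. hess_II (N + 2) (N + 3)) \<longlonglongrightarrow> (1 * 1 * 1) / ((3/2) * (3/2) * (3/2))"
  proof (rule product_quotient_limit[OF hess_II_highest])
    show "(\<lambda>N. (real N + \<alpha>0 + 4 + s N) / real N) \<longlonglongrightarrow> 3 / 2" "(\<lambda>N. (real N + \<alpha>0 + 4 + s (N + 1)) / real N) \<longlonglongrightarrow> 3 / 2"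
      "(\<lambda>N. (real N + \<alpha>0 + 4 + s (N + 2)) / real N) \<longlonglongrightarrow> 3 / 2"
      using node_lim[of 4 0] node_lim[of 4 1] node_lim[of 4 2] by simp_all
    show "(\<lambda>N. (real N + \<alpha>0 + 3) / real N) \<longlonglongrightarrow> 1" "(\<lambda>N. (real N + \<alpha>0 + 3 + \<alpha>1) / real N) \<longlonglongrightarrow> 1"
      "(\<lambda>N. (real N + \<alpha>0 + 3 + \<alpha>2) / real N) \<longlonglongrightarrow> 1"
      by real_asymp+
    show "(real N + \<alpha>0 + 4 + s N) * (real N + \<alpha>0 + 4 + s (N + 1)) * (real N + \<alpha>0 + 4 + s (N + 2)) \<noteq> 0" for N
      using pos[of 4 N N] pos[of 4 N "N + 1"] pos[of 4 N "N + 2"] by simp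
  qed simp
  then show "(\<lambda>N. hess_II (N + 2) (N + 3)) \<longlonglongrightarrow> 8 / 27"
    by simp
qed

text \<open>
  The two linear relations, with the outer entries known, form a linear system for the inner ones.
  After division of the second relation by \<open>N\<close> the determinant tends to \<open>3/2\<close>.
\<close>

lemma hess_II_lim_inner:
  "(\<lambda>N. hess_II (N + 2) (N + 1)) \<longlonglongrightarrow> 6 / 27" "(\<lambda>N. hess_II (N + 2) (N + 2)) \<longlonglongrightarrow> 12 / 27"
proof -
  define h3 h0 where "h3 N = hess_II (N + 2) (N + 3)" and "h0 N = hess_II (N + 2) N" for N
  define E where "E N = (real N + \<alpha>0 + 4 - s N - s (N + 1)) / real N" for N
  define F where "F N = (real N + \<alpha>0 + 3 + s (N + 1)) / real N" for N
  define G where "G N = (s N + s (N + 1) + s (N + 2)) / real N" for N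
  have lim30: "h3 \<longlonglongrightarrow> 8 / 27" "h0 \<longlonglongrightarrow> 1 / 27"
    using hess_II_lim_outer by (simp_all add: h3_def[abs_def] h0_def[abs_def])
  have sN: "(\<lambda>N. s (N + i) / real N) \<longlonglongrightarrow> 1 / 2" for i
    using node_lin_lim[of 0 0 i] by simp
  have E: "E \<longlonglongrightarrow> 0"
  proof -
    have "(\<lambda>N. (real N + \<alpha>0 + 4) / real N - s (N + 0) / real N - s (N + 1) / real N) \<longlonglongrightarrow> 1 - 1/2 - 1/2"
      by (intro tendsto_diff sN) real_asymp
    then show ?thesis
      by (simp add: E_def[abs_def] diff_divide_distrib)
  qed
  have G: "G \<longlonglongrightarrow> 3 / 2"
  proof -
    have "(\<lambda>N. s (N + 0) / real N + s (N + 1) / real N + s (N + 2) / real N) \<longlonglongrightarrow> 1/2 + 1/2 + 1/2"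
      by (intro tendsto_add sN)
    then show ?thesis
      by (simp add: G_def[abs_def] add_divide_distrib)
  qed
  have F: "F \<longlonglongrightarrow> 3 / 2"
    using node_lin_lim[of 1 "\<alpha>0 + 3" 1] by (simp add: F_def[abs_def] add.assoc)
  have "(\<lambda>N. ((3 - \<alpha>1 - \<alpha>2) / real N + h3 N * G N - h0 N * ((3 * (real N + \<alpha>0) + 9) / real N)
      - E N * (1 - h3 N - h0 N)) / F N) \<longlonglongrightarrow> (0 + 8/27 * (3/2) - 1/27 * 3 - 0 * (1 - 8/27 - 1/27)) / (3/2)"
    by (intro tendsto_intros lim30 E F G) (real_asymp | simp)+
  moreover have "\<forall>\<^sub>F N in sequentially. ((3 - \<alpha>1 - \<alpha>2) / real N + h3 N * G N - h0 N * ((3 * (real N + \<alpha>0) + 9) / real N)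
      - E N * (1 - h3 N - h0 N)) / F N = hess_II (N + 2) (N + 1)"
    using eventually_gt_at_top[of 0]
  proof eventually_elim
    case (elim N)
    have split_quotient: "(x + h * g - k * y - e * z) / n = x / n + h * (g / n) - k * (y / n) - e / n * z"
      for x h g k y e z n :: real
      by (simp add: add_divide_distrib diff_divide_distrib)
    \<comment> \<open>\<open>e\<close> and \<open>e + f\<close> are the coefficients of the inner entries, so \<open>f\<close> is the determinant.\<close>
    define e f g where "e = real N + \<alpha>0 + 4 - s N - s (N + 1)" and "f = real N + \<alpha>0 + 3 + s (N + 1)"
      and "g = s N + s (N + 1) + s (N + 2)"
    have f: "f > 0"
      using node_gt[of "N + 1"] \<alpha>0 by (simp add: f_def)
    have h2: "hess_II (N + 2) (N + 2) = 1 - h3 N - h0 N - hess_II (N + 2) (N + 1)"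
      using hess_II_linear_relations(1)[of N] by (simp add: h3_def h0_def)
    have "2 * (real N + \<alpha>0) + 7 - s N = e + f"
      by (simp add: e_def f_def)
    then have "3 - \<alpha>1 - \<alpha>2 = - h3 N * g + hess_II (N + 2) (N + 2) * e + hess_II (N + 2) (N + 1) * (e + f) +
        h0 N * (3 * (real N + \<alpha>0) + 9)"
      using hess_II_linear_relations(2)[of N] by (simp only: h3_def h0_def e_def g_def)
    then have "hess_II (N + 2) (N + 1) * f = (3 - \<alpha>1 - \<alpha>2) + h3 N * g - h0 N * (3 * (real N + \<alpha>0) + 9) - e * (1 - h3 N - h0 N)"
      unfolding h2 by (simp add: algebra_simps)
    then have "hess_II (N + 2) (N + 1) = ((3 - \<alpha>1 - \<alpha>2) + h3 N * g - h0 N * (3 * (real N + \<alpha>0) + 9) - e * (1 - h3 N - h0 N)) / f"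
      using f by (simp add: nonzero_eq_divide_eq)
    also have "\<dots> = (((3 - \<alpha>1 - \<alpha>2) + h3 N * g - h0 N * (3 * (real N + \<alpha>0) + 9) - e * (1 - h3 N - h0 N)) / real N) / (f / real N)"
      using elim by simp
    also have "f / real N = F N"
      by (simp add: F_def f_def)
    also have "((3 - \<alpha>1 - \<alpha>2) + h3 N * g - h0 N * (3 * (real N + \<alpha>0) + 9) - e * (1 - h3 N - h0 N)) / real N =
        (3 - \<alpha>1 - \<alpha>2) / real N + h3 N * (g / real N) - h0 N * ((3 * (real N + \<alpha>0) + 9) / real N) - e / real N * (1 - h3 N - h0 N)"
      by (rule split_quotient)
    also have "g / real N = G N"
      by (simp add: G_def g_def)
    also have "e / real N = E N"
      by (simp add: E_def e_def)
    finally show ?case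
      by simp
  qed
  ultimately have "(\<lambda>N. hess_II (N + 2) (N + 1)) \<longlonglongrightarrow> (0 + 8/27 * (3/2) - 1/27 * 3 - 0 * (1 - 8/27 - 1/27)) / (3/2)"
    by (rule Lim_transform_eventually)
  then show 1: "(\<lambda>N. hess_II (N + 2) (N + 1)) \<longlonglongrightarrow> 6 / 27"
    by simp
  have "(\<lambda>N. 1 - h3 N - h0 N - hess_II (N + 2) (N + 1)) \<longlonglongrightarrow> 1 - 8/27 - 1/27 - 6/27"
    by (intro tendsto_diff lim30 1 tendsto_const)
  moreover have "1 - h3 N - h0 N - hess_II (N + 2) (N + 1) = hess_II (N + 2) (N + 2)" for N
    using hess_II_linear_relations(1)[of N] by (simp add: h3_def h0_def)
  ultimately show "(\<lambda>N. hess_II (N + 2) (N + 2)) \<longlonglongrightarrow> 12 / 27"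
    by simp
qed

text \<open>
  The limits along rows \<open>N + 2\<close> become limits along the diagonal \<open>(n + k, n)\<close> by setting \<open>n = N + j\<close>
  with \<open>j = 2 - k\<close>. For \<open>k = -2\<close> the entries lie above the band.
\<close>

lemma hess_II_convergent:
  assumes "k \<in> {-2, -1, 0, 1, 2 :: int}"
  shows "\<exists>l. (\<lambda>n. hess_II (nat (int n + k)) n) \<longlonglongrightarrow> l"
proof -
  have shifted: "\<exists>l. (\<lambda>n. hess_II (nat (int n + k)) n) \<longlonglongrightarrow> l"
    if "k = 2 - int j" "(\<lambda>N. hess_II (N + 2) (N + j)) \<longlonglongrightarrow> l" for j l
  proof -
    have "(\<lambda>N. hess_II (nat (int (N + j) + k)) (N + j)) \<longlonglongrightarrow> l"
      using that by (simp add: nat_add_distrib)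
    then have "(\<lambda>n. hess_II (nat (int n + k)) n) \<longlonglongrightarrow> l"
      by (rule LIMSEQ_offset)
    then show ?thesis ..
  qed
  consider "k = -2" | "k = -1" | "k = 0" | "k = 1" | "k = 2"
    using assms by auto
  then show ?thesis
  proof cases
    case 1
    have "hess_II N (N + 2) = 0" for N
      by (simp add: hess_II_def hess_above)
    then have "(\<lambda>N. hess_II (nat (int (N + 2) + k)) (N + 2)) \<longlonglongrightarrow> 0"
      by (simp add: 1)
    then have "(\<lambda>n. hess_II (nat (int n + k)) n) \<longlonglongrightarrow> 0"
      by (rule LIMSEQ_offset)
    then show ?thesis ..
  next
    case 2
    show ?thesis
      by (rule shifted[where j = 3, OF _ hess_II_lim_outer(2)]) (simp add: 2)
  next
    case 3
    show ?thesis
      by (rule shifted[where j = 2, OF _ hess_II_lim_inner(2)]) (simp add: 3)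
  next
    case 4
    show ?thesis
      by (rule shifted[where j = 1, OF _ hess_II_lim_inner(1)]) (simp add: 4)
  next
    case 5
    show ?thesis
      by (rule shifted[where j = 0 and l = "1/27"]) (use hess_II_lim_outer(1) 5 in simp_all)
  qed
qed

end

theorem theorem4p5:
  fixes \<alpha>0 \<alpha>1 \<alpha>2 :: real and k :: int
  assumes "\<alpha>0 > -1" and "\<alpha>1 > -1" and "\<alpha>2 > -1"
    and "\<alpha>1 - \<alpha>2 \<notin> \<int>" and "\<bar>\<alpha>1 - \<alpha>2\<bar> < 1"
    and "k \<in> {-2, -1, 0, 1, 2}"
  shows "convergent (\<lambda>n. jp_H_typeI \<alpha>0 \<alpha>1 \<alpha>2 n (nat (int n + k)))
    \<and> convergent (\<lambda>n. jp_H_typeII \<alpha>0 \<alpha>1 \<alpha>2 (nat (int n + k)) n)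
    \<and> lim (\<lambda>n. jp_H_typeI \<alpha>0 \<alpha>1 \<alpha>2 n (nat (int n + k)))
      = lim (\<lambda>n. jp_H_typeII \<alpha>0 \<alpha>1 \<alpha>2 (nat (int n + k)) n)"
proof -
  interpret jacobi_pineiro \<alpha>1 \<alpha>2 \<alpha>0
    using assms by unfold_locales
  obtain l where l: "(\<lambda>n. hess_II (nat (int n + k)) n) \<longlonglongrightarrow> l"
    using hess_II_convergent[OF assms(6)] by blast
  then have II: "(\<lambda>n. jp_H_typeII \<alpha>0 \<alpha>1 \<alpha>2 (nat (int n + k)) n) \<longlonglongrightarrow> l"
    by (simp add: jp_H_typeII_eq)
  have "(\<lambda>n. hess_II (nat (int n + k)) n * (endpoint (nat (int n + k)) / endpoint n)) \<longlonglongrightarrow> l * 1"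
    by (intro tendsto_mult l endpoint_ratio_int)
  then have I: "(\<lambda>n. jp_H_typeI \<alpha>0 \<alpha>1 \<alpha>2 n (nat (int n + k))) \<longlonglongrightarrow> l"
    by (simp add: jp_H_typeI_eq)
  show ?thesis
    using I II by (auto simp: convergent_def limI)
qed

end
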